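(* Let $q$ be a nonzero complex number with $q\neq\pm1$. There exists a unique homomorphism of unital associative algebras $\phi:U'_q(\mathrm{so}_4)\to \hat U_q(\mathrm{sl}_2)^{\otimes 2,\mathrm{ext}}$ such that $$\phi(I_{21})=\mathrm i\,\frac{q^{H_1}q^{H_2}-q^{-H_1}q^{-H_2}}{q-q^{-1}},\qquad \phi(I_{43})=\mathrm i\,\frac{q^{H_1}q^{-H_2}-q^{-H_1}q^{H_2}}{q-q^{-1}},$$ $$\phi(I_{32})=-\frac{x_1^{-1}q^{-H_2+1}+x_1q^{H_2-1}}{(q^{H_1+H_2-1}+q^{-H_1-H_2+1})(q^{H_1-H_2+1}+q^{-H_1+H_2-1})}\,e_2$$ $$+\frac{x_1^{-1}q^{H_2+1}+x_1q^{-H_2-1}}{(q^{H_1+H_2+1}+q^{-H_1-H_2-1})(q^{H_1-H_2-1}+q^{-H_1+H_2+1})}\,f_2$$ $$+\frac{x_2^{-1}q^{-H_1+1}+x_2q^{H_1-1}}{(q^{H_1+H_2-1}+q^{-H_1-H_2+1})(q^{H_1-H_2-1}+q^{-H_1+H_2+1})}\,e_1$$ $$-\frac{x_2^{-1}q^{H_1+1}+x_2q^{-H_1-1}}{(q^{H_1+H_2+1}+q^{-H_1-H_2-1})(q^{H_1-H_2+1}+q^{-H_1+H_2-1})}\,f_1 .$$ (Each fraction is a product of mutually commuting elements, and it multiplies the generator standing to its right from the left.)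
   Context: All algebras are unital associative algebras over $\mathbb C$; $\mathrm i=\sqrt{-1}$. The algebra $U'_q(\mathrm{so}_4)$ is generated by $I_{21},I_{32},I_{43}$ with defining relations $$I_{21}I_{32}^2-(q+q^{-1})I_{32}I_{21}I_{32}+I_{32}^2I_{21}=-I_{21},\quad I_{32}I_{21}^2-(q+q^{-1})I_{21}I_{32}I_{21}+I_{21}^2I_{32}=-I_{32},$$ $$I_{32}I_{43}^2-(q+q^{-1})I_{43}I_{32}I_{43}+I_{43}^2I_{32}=-I_{32},\quad I_{43}I_{32}^2-(q+q^{-1})I_{32}I_{43}I_{32}+I_{32}^2I_{43}=-I_{43},$$ $$I_{21}I_{43}=I_{43}I_{21}.$$ For $i=1,2$ let $U_q(\mathrm{sl}_2)$ (the $i$-th copy) be generated by $e_i,f_i,q^{H_i},q^{-H_i}$ with $q^{H_i}q^{-H_i}=q^{-H_i}q^{H_i}=1$, $q^{H_i}e_i=q\,e_iq^{H_i}$, $q^{H_i}f_i=q^{-1}f_iq^{H_i}$, $[e_i,f_i]=\frac{q^{2H_i}-q^{-2H_i}}{q-q^{-1}}$, where $q^{\pm 2H_i}=(q^{\pm H_i})^2$. Its Casimir element is $c_i=e_if_i+\frac{q^{2H_i-1}+q^{-2H_i+1}}{(q-q^{-1})^2}$. Let $\hat U_q(\mathrm{sl}_2)$ be the extension of $U_q(\mathrm{sl}_2)$ by an element $x_i$ commuting with all elements of $U_q(\mathrm{sl}_2)$ and subject to $q^{-1}x_i^4-c_i(q-q^{-1})^2x_i^2+q=0$ (so the elements are $a_3x_i^3+a_2x_i^2+a_1x_i+a_0$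 with $a_r\in U_q(\mathrm{sl}_2)$). The element $x_i$ is invertible, with $x_i^{-1}=q^{-1}(-q^{-1}x_i^3+c_i(q-q^{-1})^2x_i)$. Let $\hat U_q(\mathrm{sl}_2)^{\otimes 2}$ be the tensor product of the two copies (generators with index 1 commute with generators with index 2). The algebra $\hat U_q(\mathrm{sl}_2)^{\otimes 2,\mathrm{ext}}$ is obtained by adjoining to it the inverses, for all $j\in\mathbb Z$, of the elements $$q^{H_1+H_2+j}+q^{-H_1-H_2-j}:=q^jq^{H_1}q^{H_2}+q^{-j}q^{-H_1}q^{-H_2},\qquad q^{H_1-H_2+j}+q^{-H_1+H_2-j}:=q^jq^{H_1}q^{-H_2}+q^{-j}q^{-H_1}q^{H_2}.$$ These inverses commute with each other, with $q^{\pm H_1},q^{\pm H_2}$ and with $x_1,x_2$, and satisfy $(q^{H_1+H_2+j}+q^{-H_1-H_2-j})^{-1}e_i=e_i(q^{H_1+H_2+j+1}+q^{-H_1-H_2-j-1})^{-1}$, $(q^{H_1+H_2+j}+q^{-H_1-H_2-j})^{-1}f_i=f_i(q^{H_1+H_2+j-1}+q^{-H_1-H_2-j+1})^{-1}$, $(q^{H_1-H_2+j}+q^{-H_1+H_2-j})^{-1}e_i=e_i(q^{H_1-H_2+j+\varepsilon}+q^{-H_1+H_2-j-\varepsilon})^{-1}$, $(q^{H_1-H_2+j}+q^{-H_1+H_2-j})^{-1}f_i=f_i(q^{H_1-H_2+j-\varepsilon}+q^{-H_1+H_2-j+\varepsilon})^{-1}$, where $\varepsilon=1$ for $i=1$ and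 $\varepsilon=-1$ for $i=2$. Also $q^{\pm H_i+r}:=q^{r}q^{\pm H_i}$ for $r\in\mathbb Z$. *)

theory Defs
  imports Complex_Main "HOL-Library.Poly_Mapping" "HOL-Algebra.QuotRing" "HOL-Algebra.Module"
begin

section \<open>Unital associative complex algebras given by generators and relations\<close>

text \<open>Words, as an additively written free monoid: the product of \<^typ>\<open>'k \<Rightarrow>\<^sub>0 complex\<close> is then
  the monoid-algebra product, so finitely supported functions on words form the free unital
  associative algebra.\<close>

datatype 'g fmonoid = FMon "'g list"

instantiation fmonoid :: (type) monoid_add
begin

definition zero_fmonoid :: "'g fmonoid" where
  "zero_fmonoid = FMon []"

fun plus_fmonoid :: "'g fmonoid \<Rightarrow> 'g fmonoid \<Rightarrow> 'g fmonoid" where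
  "plus_fmonoid (FMon u) (FMon v) = FMon (u @ v)"

instance
proof
  fix a b c :: "'g fmonoid"
  show "a + b + c = a + (b + c)" by (cases a; cases b; cases c) simp
  show "0 + a = a" by (cases a) (simp add: zero_fmonoid_def)
  show "a + 0 = a" by (cases a) (simp add: zero_fmonoid_def)
qed

end

type_synonym 'g free_alg = "'g fmonoid \<Rightarrow>\<^sub>0 complex"

definition gen :: "'g \<Rightarrow> 'g free_alg" where
  "gen g = Poly_Mapping.single (FMon [g]) 1"

definition sc :: "complex \<Rightarrow> 'g free_alg" where
  "sc c = Poly_Mapping.single 0 c"

definition free_ring :: "'g free_alg ring" where
  "free_ring = \<lparr>carrier = UNIV, mult = (*), one = 1, zero = 0, add = (+)\<rparr>"

lemma ring_free_ring: "ring free_ring"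
proof (rule ringI)
  show "abelian_group (free_ring :: 'g free_alg ring)"
  proof (rule abelian_groupI)
    fix x :: "'g free_alg"
    assume "x \<in> carrier free_ring"
    show "\<exists>y\<in>carrier free_ring. y \<oplus>\<^bsub>free_ring\<^esub> x = \<zero>\<^bsub>free_ring\<^esub>"
      by (rule bexI[of _ "- x"]) (simp_all add: free_ring_def)
  qed (simp_all add: free_ring_def algebra_simps)
  show "Group.monoid (free_ring :: 'g free_alg ring)"
    by (rule monoidI) (simp_all add: free_ring_def algebra_simps)
qed (simp_all add: free_ring_def algebra_simps)

text \<open>A set \<open>R\<close> of elements of the free algebra stands for the relations \<open>r = 0\<close> with \<open>r \<in> R\<close>.\<close>

definition rel_ideal :: "'g free_alg set \<Rightarrow> 'g free_alg set" where
  "rel_ideal R = genideal free_ring R"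

definition cls :: "'g free_alg set \<Rightarrow> 'g free_alg \<Rightarrow> 'g free_alg set" where
  "cls R a = rel_ideal R +>\<^bsub>free_ring\<^esub> a"

definition presented_alg :: "'g free_alg set \<Rightarrow> (complex, 'g free_alg set) module" where
  "presented_alg R = ring.extend (free_ring Quot rel_ideal R)
     (module.fields (\<lambda>c X. cls R (sc c) \<otimes>\<^bsub>free_ring Quot rel_ideal R\<^esub> X))"

text \<open>The library locale \<^locale>\<open>algebra\<close> covers only commutative algebras, hence an own notion
  of algebra homomorphism; \<^const>\<open>ring_hom\<close> includes preservation of the unit.
  Extensionality makes a homomorphism determined by its values on the carrier.\<close>

definition alg_hom ::
    "('c, 'a, 'm) module_scheme \<Rightarrow> ('c, 'b, 'n) module_scheme \<Rightarrow> ('a \<Rightarrow> 'b) set" where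
  "alg_hom A B = {h \<in> ring_hom A B \<inter> extensional (carrier A).
     \<forall>c. \<forall>a\<in>carrier A. h (c \<odot>\<^bsub>A\<^esub> a) = c \<odot>\<^bsub>B\<^esub> h a}"


section \<open>The algebra \<open>U'\<^sub>q(so\<^sub>4)\<close>\<close>

datatype so4_gen = I21 | I32 | I43

definition q_serre :: "complex \<Rightarrow> 'g free_alg \<Rightarrow> 'g free_alg \<Rightarrow> 'g free_alg" where
  "q_serre q a b = a * b^2 - sc (q + inverse q) * (b * a * b) + b^2 * a + a"

definition so4_rels :: "complex \<Rightarrow> so4_gen free_alg set" where
  "so4_rels q =
    {q_serre q (gen I21) (gen I32), q_serre q (gen I32) (gen I21),
     q_serre q (gen I32) (gen I43), q_serre q (gen I43) (gen I32),
     gen I21 * gen I43 - gen I43 * gen I21}"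

definition U'_so4 :: "complex \<Rightarrow> (complex, so4_gen free_alg set) module" where
  "U'_so4 q = presented_alg (so4_rels q)"


section \<open>The extended tensor square of \<open>U\<^sub>q(sl\<^sub>2)\<close> with adjoined \<open>x\<^sub>i\<close>\<close>

text \<open>\<open>K i\<close> and \<open>Kinv i\<close> stand for \<open>q\<close> to the powers \<open>H\<^sub>i\<close> and \<open>-H\<^sub>i\<close>; \<open>Pinv j\<close> and \<open>Minv j\<close> are
  the adjoined inverses of the elements \<open>hplus q j\<close> and \<open>hminus q j\<close> below.\<close>

datatype copy = First | Second

datatype ext_gen = E copy | F copy | K copy | Kinv copy | X copy | Pinv int | Minv int

definition casimir :: "complex \<Rightarrow> copy \<Rightarrow> ext_gen free_alg" where
  "casimir q i = gen (E i) * gen (F i) +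
     sc (1 / (q - inverse q)^2) * (sc (inverse q) * gen (K i)^2 + sc q * gen (Kinv i)^2)"

definition sl2_rels :: "complex \<Rightarrow> copy \<Rightarrow> ext_gen free_alg set" where
  "sl2_rels q i =
    {gen (K i) * gen (Kinv i) - 1,
     gen (Kinv i) * gen (K i) - 1,
     gen (K i) * gen (E i) - sc q * (gen (E i) * gen (K i)),
     gen (K i) * gen (F i) - sc (inverse q) * (gen (F i) * gen (K i)),
     gen (E i) * gen (F i) - gen (F i) * gen (E i)
       - sc (1 / (q - inverse q)) * (gen (K i)^2 - gen (Kinv i)^2)}"

definition hat_sl2_rels :: "complex \<Rightarrow> copy \<Rightarrow> ext_gen free_alg set" where
  "hat_sl2_rels q i = sl2_rels q i \<union>
    {gen (X i) * gen g - gen g * gen (X i) | g. g \<in> {E i, F i, K i, Kinv i}} \<union>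
    {sc (inverse q) * gen (X i)^4 - casimir q i * sc ((q - inverse q)^2) * gen (X i)^2 + sc q}"

definition hat_sl2_gens :: "copy \<Rightarrow> ext_gen set" where
  "hat_sl2_gens i = {E i, F i, K i, Kinv i, X i}"

definition tensor_rels :: "complex \<Rightarrow> ext_gen free_alg set" where
  "tensor_rels q = hat_sl2_rels q First \<union> hat_sl2_rels q Second \<union>
    {gen g * gen h - gen h * gen g | g h. g \<in> hat_sl2_gens First \<and> h \<in> hat_sl2_gens Second}"

definition hplus :: "complex \<Rightarrow> int \<Rightarrow> ext_gen free_alg" where
  "hplus q j = sc (q powi j) * gen (K First) * gen (K Second)
     + sc (q powi (- j)) * gen (Kinv First) * gen (Kinv Second)"

definition hminus :: "complex \<Rightarrow> int \<Rightarrow> ext_gen free_alg" where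
  "hminus q j = sc (q powi j) * gen (K First) * gen (Kinv Second)
     + sc (q powi (- j)) * gen (Kinv First) * gen (K Second)"

text \<open>The commutation rules of the adjoined inverses with the other generators and with each other
  follow from the two-sided inverse relations, by conjugating the corresponding rules for
  \<open>hplus q j\<close> and \<open>hminus q j\<close>.\<close>

definition ext_rels :: "complex \<Rightarrow> ext_gen free_alg set" where
  "ext_rels q = tensor_rels q \<union>
    (\<Union>j. {hplus q j * gen (Pinv j) - 1, gen (Pinv j) * hplus q j - 1,
           hminus q j * gen (Minv j) - 1, gen (Minv j) * hminus q j - 1})"

definition U_sl2_ext :: "complex \<Rightarrow> (complex, ext_gen free_alg set) module" where
  "U_sl2_ext q = presented_alg (ext_rels q)"

definition xinv :: "complex \<Rightarrow> copy \<Rightarrow> ext_gen free_alg" where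
  "xinv q i = sc (inverse q) *
     (- (sc (inverse q) * gen (X i)^3) + casimir q i * sc ((q - inverse q)^2) * gen (X i))"


section \<open>Representatives of the images of the generators\<close>

definition img21 :: "complex \<Rightarrow> ext_gen free_alg" where
  "img21 q = sc (\<i> / (q - inverse q)) *
     (gen (K First) * gen (K Second) - gen (Kinv First) * gen (Kinv Second))"

definition img43 :: "complex \<Rightarrow> ext_gen free_alg" where
  "img43 q = sc (\<i> / (q - inverse q)) *
     (gen (K First) * gen (Kinv Second) - gen (Kinv First) * gen (K Second))"

definition img32 :: "complex \<Rightarrow> ext_gen free_alg" where
  "img32 q =
     - ((xinv q First * (sc q * gen (Kinv Second)) + gen (X First) * (sc (inverse q) * gen (K Second)))
          * gen (Pinv (-1)) * gen (Minv 1) * gen (E Second))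
     + (xinv q First * (sc q * gen (K Second)) + gen (X First) * (sc (inverse q) * gen (Kinv Second)))
          * gen (Pinv 1) * gen (Minv (-1)) * gen (F Second)
     + (xinv q Second * (sc q * gen (Kinv First)) + gen (X Second) * (sc (inverse q) * gen (K First)))
          * gen (Pinv (-1)) * gen (Minv (-1)) * gen (E First)
     - (xinv q Second * (sc q * gen (K First)) + gen (X Second) * (sc (inverse q) * gen (Kinv First)))
          * gen (Pinv 1) * gen (Minv 1) * gen (F First)"

end

theory Submission
  imports Defs
begin

text \<open>
  Put \<open>A = q\<^bsup>H\<^sub>1+H\<^sub>2\<^esup>\<close> and \<open>B = q\<^bsup>H\<^sub>1-H\<^sub>2\<^esup>\<close>. The images of \<open>I\<^sub>2\<^sub>1\<close> and \<open>I\<^sub>4\<^sub>3\<close> are functions of \<open>A\<close> and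
  \<open>B\<close>, and the image of \<open>I\<^sub>3\<^sub>2\<close> is a sum of four terms that are eigenvectors, with eigenvalues
  \<open>q\<^sup>\<plusminus>\<^sup>1\<close>, of conjugation by \<open>A\<close> and by \<open>B\<close>. The Serre relation that is linear in \<open>I\<^sub>3\<^sub>2\<close> holds for
  each term separately. If \<open>S\<close> and \<open>T\<close> are the parts of \<open>I\<^sub>3\<^sub>2\<close> of \<open>A\<close>-weight \<open>1\<close> and \<open>-1\<close>, the one that
  is quadratic in \<open>I\<^sub>3\<^sub>2\<close> amounts to
  \<open>S T (q\<^sup>-\<^sup>1 A + q A\<^sup>-\<^sup>1) - T S (q A + q\<^sup>-\<^sup>1 A\<^sup>-\<^sup>1) = - (A - A\<^sup>-\<^sup>1) / (q - q\<^sup>-\<^sup>1)\<close>.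
  Its components of \<open>B\<close>-weight \<open>\<plusminus>2\<close> hold because the two copies of \<open>U\<^sub>q(sl\<^sub>2)\<close> commute. In
  \<open>B\<close>-weight \<open>0\<close> only products \<open>e\<^sub>i f\<^sub>i\<close> and \<open>f\<^sub>i e\<^sub>i\<close> occur, which are functions of \<open>q\<^bsup>H\<^sub>i\<^esup>\<close> and of the
  Casimir element \<open>c\<^sub>i\<close>; by the equation of \<open>x\<^sub>i\<close> so are their coefficients, and an identity of
  commuting elements remains. The automorphism \<open>e\<^sub>2 \<mapsto> -f\<^sub>2\<close>, \<open>f\<^sub>2 \<mapsto> -e\<^sub>2\<close>,
  \<open>q\<^bsup>H\<^sub>2\<^esup> \<mapsto> q\<^bsup>-H\<^sub>2\<^esup>\<close> exchanges the images of \<open>I\<^sub>2\<^sub>1\<close> and \<open>I\<^sub>4\<^sub>3\<close> and fixes that of \<open>I\<^sub>3\<^sub>2\<close>, which gives the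
  relations between \<open>I\<^sub>4\<^sub>3\<close> and \<open>I\<^sub>3\<^sub>2\<close>.
\<close>

section \<open>Homomorphisms between presented algebras\<close>

lemma ideal_rel_ideal: "ideal (rel_ideal R) free_ring"
  unfolding rel_ideal_def
  by (rule ring.genideal_ideal[OF ring_free_ring]) (simp add: free_ring_def)

lemma rel_ideal_base: "r \<in> R \<Longrightarrow> r \<in> rel_ideal R"
  unfolding rel_ideal_def
  using ring.genideal_self[OF ring_free_ring, of R] by (auto simp: free_ring_def)

lemma rel_ideal_mult_left: "a \<in> rel_ideal R \<Longrightarrow> b * a \<in> rel_ideal R"
  using ideal.I_l_closed[OF ideal_rel_ideal, of a R b] by (simp add: free_ring_def)

lemma rel_ideal_mult_right: "a \<in> rel_ideal R \<Longrightarrow> a * b \<in> rel_ideal R"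
  using ideal.I_r_closed[OF ideal_rel_ideal, of a R b] by (simp add: free_ring_def)

lemma rel_ideal_zero: "0 \<in> rel_ideal R"
  using additive_subgroup.zero_closed[OF ideal.axioms(1)[OF ideal_rel_ideal], of R]
  by (simp add: free_ring_def)

lemma rel_ideal_add: "a \<in> rel_ideal R \<Longrightarrow> b \<in> rel_ideal R \<Longrightarrow> a + b \<in> rel_ideal R"
  using additive_subgroup.a_closed[OF ideal.axioms(1)[OF ideal_rel_ideal], of a R b]
  by (simp add: free_ring_def)

lemma rel_ideal_uminus: "a \<in> rel_ideal R \<Longrightarrow> - a \<in> rel_ideal R"
  using rel_ideal_mult_left[of a R "- 1"] by simp

lemma rel_ideal_diff: "a \<in> rel_ideal R \<Longrightarrow> b \<in> rel_ideal R \<Longrightarrow> a - b \<in> rel_ideal R"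
  using rel_ideal_add[of a R "- b"] rel_ideal_uminus[of b R] by simp

text \<open>Negation is multiplication by -1, so the closure conditions on \<open>J\<close> already
  make it a two-sided ideal. \<open>J\<close> will be the preimage of an ideal under an evaluation
  map.\<close>

lemma rel_ideal_minimal:
  assumes "R \<subseteq> J" and "0 \<in> J" and "\<And>a b. a \<in> J \<Longrightarrow> b \<in> J \<Longrightarrow> a + b \<in> J"
    and "\<And>a b. a \<in> J \<Longrightarrow> b * a \<in> J" and "\<And>a b. a \<in> J \<Longrightarrow> a * b \<in> J"
  shows "rel_ideal R \<subseteq> J"
proof -
  interpret ring "free_ring :: 'a free_alg ring" by (rule ring_free_ring)
  have neg: "- a \<in> J" if "a \<in> J" for a
    using assms(4)[OF that, of "- 1"] by simp
  have inv: "\<ominus>\<^bsub>free_ring\<^esub> a = - a" for a :: "'a free_alg"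
    using minus_equality[of "- a" a] by (simp add: free_ring_def)
  have "ideal J free_ring"
  proof (rule idealI[OF ring_axioms])
    show "subgroup J (add_monoid free_ring)"
      by (rule add.subgroupI) (use assms(2,3) neg inv in \<open>auto simp: free_ring_def\<close>)
  qed (use assms in \<open>auto simp: free_ring_def\<close>)
  then show ?thesis
    unfolding rel_ideal_def by (rule genideal_minimal) (rule assms(1))
qed

lemma cls_eq_iff: "cls R a = cls R b \<longleftrightarrow> a - b \<in> rel_ideal R"
proof -
  interpret ideal "rel_ideal R" "free_ring :: 'a free_alg ring" by (rule ideal_rel_ideal)
  have "cls R c = {i + c | i. i \<in> rel_ideal R}" for c
    by (auto simp: cls_def a_r_coset_def r_coset_def free_ring_def)
  note cls = this
  show ?thesis
  proof
    assume "cls R a = cls R b"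
    moreover have "a \<in> cls R a" using rel_ideal_zero by (force simp: cls)
    ultimately show "a - b \<in> rel_ideal R" by (auto simp: cls)
  next
    assume d: "a - b \<in> rel_ideal R"
    have "i + a = (i + (a - b)) + b" "i + b = (i - (a - b)) + a" for i by simp_all
    then show "cls R a = cls R b"
      using rel_ideal_add[OF _ d] rel_ideal_diff[OF _ d] unfolding cls by blast
  qed
qed

lemma carrier_presented_alg: "carrier (presented_alg R) = range (cls R)"
  by (auto simp: presented_alg_def ring.defs module.defs FactRing_def A_RCOSETS_defs a_r_coset_def
      cls_def free_ring_def)

lemma mult_presented_alg: "cls R a \<otimes>\<^bsub>presented_alg R\<^esub> cls R b = cls R (a * b)"
  using ideal.rcoset_mult_add[OF ideal_rel_ideal, of a b R]
  by (simp add: presented_alg_def ring.defs module.defs FactRing_def cls_def free_ring_def)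

lemma add_presented_alg: "cls R a \<oplus>\<^bsub>presented_alg R\<^esub> cls R b = cls R (a + b)"
  using ideal.a_rcos_sum[OF ideal_rel_ideal, of a b R]
  by (simp add: presented_alg_def ring.defs module.defs FactRing_def cls_def free_ring_def)

lemma one_presented_alg: "\<one>\<^bsub>presented_alg R\<^esub> = cls R 1"
  by (simp add: presented_alg_def ring.defs module.defs FactRing_def cls_def free_ring_def)

lemma smult_presented_alg: "c \<odot>\<^bsub>presented_alg R\<^esub> cls R a = cls R (sc c * a)"
  using mult_presented_alg[of R "sc c" a]
  by (simp add: presented_alg_def ring.defs module.defs)

lemmas presented_alg_simps =
  carrier_presented_alg mult_presented_alg add_presented_alg one_presented_alg smult_presented_alg

section \<open>Scalars and evaluation maps on free algebras\<close>

lemma sc_0 [simp]: "sc 0 = 0" and sc_1 [simp]: "sc 1 = 1"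
  by (simp_all add: sc_def)

lemma sc_add: "sc (a + b) = sc a + sc b"
  by (simp add: sc_def single_add)

lemma sc_diff: "sc (a - b) = sc a - sc b"
  by (simp add: sc_def single_diff)

lemma sc_mult: "sc (a * b) = sc a * sc b"
  by (simp add: sc_def mult_single)

text \<open>Setting the coefficient of a word outside the support amounts to adding a monomial; in
  this form the induction suits additive maps.\<close>

lemma free_alg_induct [case_names zero add]:
  assumes "P 0" and "\<And>a w c. P a \<Longrightarrow> P (a + Poly_Mapping.single w c)"
  shows "P (a :: 'g free_alg)"
proof (induction a rule: update_induct)
  case const
  show ?case by (rule assms(1))
next
  case (update a w c)
  have "Poly_Mapping.update w c a = a + Poly_Mapping.single w c"
    using update(1) by (intro poly_mapping_eqI)
      (auto simp: lookup_update lookup_add lookup_single in_keys_iff when_def)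
  then show ?case using assms(2) update by simp
qed

lemma sc_commute: "a * sc c = sc c * a"
proof (induction a rule: free_alg_induct)
  case (add a w d)
  then show ?case by (simp add: algebra_simps sc_def mult_single)
qed simp

lemma single_Cons: "Poly_Mapping.single (FMon (g # u)) c = gen g * Poly_Mapping.single (FMon u) c"
  by (simp add: gen_def mult_single)

lemma single_Nil: "Poly_Mapping.single (FMon []) c = sc c"
  by (simp add: sc_def zero_fmonoid_def)

fun word_eval :: "('g \<Rightarrow> 'h free_alg) \<Rightarrow> 'g fmonoid \<Rightarrow> 'h free_alg" where
  "word_eval f (FMon u) = prod_list (map f u)"

lemma word_eval_plus: "word_eval f (v + w) = word_eval f v * word_eval f w"
  by (cases v; cases w) simp

definition free_lift :: "('g \<Rightarrow> 'h free_alg) \<Rightarrow> 'g free_alg \<Rightarrow> 'h free_alg" where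
  "free_lift f a = (\<Sum>w\<in>Poly_Mapping.keys a. sc (Poly_Mapping.lookup a w) * word_eval f w)"

text \<open>Cancellation can shrink the support of a sum. A common index set lets the three sums in
  \<open>free_lift_add\<close> be compared termwise.\<close>

lemma free_lift_superset:
  assumes "finite S" and "Poly_Mapping.keys a \<subseteq> S"
  shows "free_lift f a = (\<Sum>w\<in>S. sc (Poly_Mapping.lookup a w) * word_eval f w)"
  unfolding free_lift_def
  by (rule sum.mono_neutral_left) (use assms in \<open>auto simp: in_keys_iff\<close>)

lemma free_lift_0 [simp]: "free_lift f 0 = 0"
  by (simp add: free_lift_def)

lemma free_lift_add: "free_lift f (a + b) = free_lift f a + free_lift f b"
proof -
  let ?S = "Poly_Mapping.keys a \<union> Poly_Mapping.keys b"
  have "Poly_Mapping.keys (a + b) \<subseteq> ?S" by (rule Poly_Mapping.keys_add)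
  then show ?thesis
    by (simp add: free_lift_superset[of ?S] lookup_add sc_add distrib_right sum.distrib)
qed

lemma free_lift_single: "free_lift f (Poly_Mapping.single w c) = sc c * word_eval f w"
  by (simp add: free_lift_def)

lemma free_lift_gen [simp]: "free_lift f (gen g) = f g"
  by (simp add: gen_def free_lift_single)

lemma free_lift_sc [simp]: "free_lift f (sc c) = sc c"
  by (simp add: sc_def[of c] free_lift_single zero_fmonoid_def)

lemma free_lift_1 [simp]: "free_lift f 1 = 1"
  using free_lift_sc[of f 1] by simp

lemma free_lift_uminus: "free_lift f (- a) = - free_lift f a"
  using free_lift_add[of f a "- a"] by (simp add: eq_neg_iff_add_eq_0 add.commute)

lemma free_lift_diff: "free_lift f (a - b) = free_lift f a - free_lift f b"
  using free_lift_add[of f a "- b"] by (simp add: free_lift_uminus)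

lemma free_lift_mult: "free_lift f (a * b) = free_lift f a * free_lift f b"
proof (induction a rule: free_alg_induct)
  case (add a w c)
  have "free_lift f (Poly_Mapping.single w c * b)
      = free_lift f (Poly_Mapping.single w c) * free_lift f b"
  proof (induction b rule: free_alg_induct)
    case (add b v d)
    have "word_eval f w * (sc d * z) = sc d * (word_eval f w * z)" for z
      by (metis mult.assoc sc_commute)
    then show ?case
      using add by (simp add: distrib_left free_lift_add mult_single free_lift_single
          word_eval_plus sc_mult mult.assoc)
  qed simp
  then show ?case using add by (simp add: distrib_right free_lift_add)
qed simp

lemmas free_lift_simps = free_lift_add free_lift_diff free_lift_uminus free_lift_mult

section \<open>Uniqueness and existence of homomorphisms\<close>

text \<open>Unit and linearity fix the values on scalars, multiplicativity then those on monomials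
  letter by letter, and additivity those on all classes.\<close>

lemma alg_hom_presented_eqI:
  assumes "h \<in> alg_hom (presented_alg R) (presented_alg S)"
    and "h' \<in> alg_hom (presented_alg R) (presented_alg S)"
    and gen: "\<And>g. h (cls R (gen g)) = h' (cls R (gen g))"
  shows "h = h'"
proof (rule extensionalityI)
  show "h \<in> extensional (carrier (presented_alg R))" "h' \<in> extensional (carrier (presented_alg R))"
    using assms by (simp_all add: alg_hom_def)
  have hom: "k (cls R 1) = cls S 1 \<and>
      k (cls R (a + b)) = k (cls R a) \<oplus>\<^bsub>presented_alg S\<^esub> k (cls R b) \<and>
      k (cls R (a * b)) = k (cls R a) \<otimes>\<^bsub>presented_alg S\<^esub> k (cls R b) \<and>
      k (cls R (sc c * a)) = c \<odot>\<^bsub>presented_alg S\<^esub> k (cls R a)"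
    if "k \<in> alg_hom (presented_alg R) (presented_alg S)" for k a b c
  proof -
    have k: "k \<in> ring_hom (presented_alg R) (presented_alg S)"
      using that by (simp add: alg_hom_def)
    have c: "cls R a \<in> carrier (presented_alg R)" for a
      by (simp add: carrier_presented_alg)
    have "k (c \<odot>\<^bsub>presented_alg R\<^esub> cls R a) = c \<odot>\<^bsub>presented_alg S\<^esub> k (cls R a)"
      using that c by (simp add: alg_hom_def)
    then show ?thesis
      using ring_hom_one[OF k] ring_hom_add[OF k c c, of a b] ring_hom_mult[OF k c c, of a b]
      by (simp add: presented_alg_simps)
  qed
  note hom = hom[OF assms(1)] hom[OF assms(2)]
  have sc: "h (cls R (sc c)) = h' (cls R (sc c))" for c
    using hom(1)[of 1 1 c] hom(2)[of 1 1 c] by simp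
  have "h (cls R a) = h' (cls R a)" for a
  proof (induction a rule: free_alg_induct)
    case zero
    show ?case using sc[of 0] by simp
  next
    case (add a w c)
    have "h (cls R (Poly_Mapping.single (FMon u) c))
        = h' (cls R (Poly_Mapping.single (FMon u) c))" for u
      by (induction u) (simp_all add: single_Nil single_Cons hom sc gen)
    then show ?case using add by (cases w) (simp add: hom)
  qed
  then show "h x = h' x" if "x \<in> carrier (presented_alg R)" for x
    using that by (auto simp: carrier_presented_alg)
qed

text \<open>The preimage of \<open>rel_ideal S\<close> under \<open>free_lift f\<close> is a
  two-sided ideal containing \<open>R\<close>, hence contains \<open>rel_ideal R\<close>, and the
  evaluation descends to classes.\<close>

lemma presented_alg_universal:
  assumes "\<And>r. r \<in> R \<Longrightarrow> free_lift f r \<in> rel_ideal S"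
  shows "\<exists>!h. h \<in> alg_hom (presented_alg R) (presented_alg S) \<and>
    (\<forall>g. h (cls R (gen g)) = cls S (f g))"
proof (rule ex_ex1I)
  have "rel_ideal R \<subseteq> {a. free_lift f a \<in> rel_ideal S}"
    by (rule rel_ideal_minimal) (use assms in \<open>auto simp: free_lift_simps
        intro: rel_ideal_zero rel_ideal_add rel_ideal_mult_left rel_ideal_mult_right\<close>)
  then have wd: "cls S (free_lift f a) = cls S (free_lift f b)" if "cls R a = cls R b" for a b
    using that by (auto simp: cls_eq_iff free_lift_diff)
  \<comment> \<open>A representative of each class is chosen; \<open>wd\<close> makes the value
    independent of the choice, and \<open>restrict\<close> provides extensionality.\<close>
  define h where
    "h = restrict (\<lambda>A. cls S (free_lift f (SOME a. cls R a = A))) (carrier (presented_alg R))"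
  have h: "h (cls R a) = cls S (free_lift f a)" for a
  proof -
    have "cls R (SOME b. cls R b = cls R a) = cls R a" by (rule someI) (rule refl)
    then show ?thesis by (auto simp: h_def carrier_presented_alg dest: wd)
  qed
  have "h \<in> alg_hom (presented_alg R) (presented_alg S)"
    unfolding alg_hom_def
    by (auto intro!: ring_hom_memI simp: presented_alg_simps h free_lift_simps)
      (auto simp: h_def carrier_presented_alg)
  then show "\<exists>h. h \<in> alg_hom (presented_alg R) (presented_alg S) \<and>
      (\<forall>g. h (cls R (gen g)) = cls S (f g))"
    using h by (intro exI[of _ h]) simp
qed (auto intro: alg_hom_presented_eqI)

section \<open>Serre relations for weight vectors\<close>

inductive_set generated_subring :: "'a::ring set \<Rightarrow> 'a set" for G where
  base: "a \<in> G \<Longrightarrow> a \<in> generated_subring G"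
| add: "a \<in> generated_subring G \<Longrightarrow> b \<in> generated_subring G \<Longrightarrow> a + b \<in> generated_subring G"
| diff: "a \<in> generated_subring G \<Longrightarrow> b \<in> generated_subring G \<Longrightarrow> a - b \<in> generated_subring G"
| mult: "a \<in> generated_subring G \<Longrightarrow> b \<in> generated_subring G \<Longrightarrow> a * b \<in> generated_subring G"

lemma commute_generated_subring:
  fixes b :: "'a::ring"
  assumes "a \<in> generated_subring G" and "\<And>c. c \<in> G \<Longrightarrow> c * b = b * c"
  shows "a * b = b * a"
  using assms(1)
proof induction
  case (mult a c)
  then show ?case by (metis mult.assoc)
qed (simp_all add: assms(2) algebra_simps)

lemma generated_subring_commute:
  fixes a b :: "'a::ring"
  assumes "\<And>a b. a \<in> G \<Longrightarrow> b \<in> G \<Longrightarrow> a * b = b * a"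
    and "a \<in> generated_subring G" and "b \<in> generated_subring G"
  shows "a * b = b * a"
  using assms(2)
  by (rule commute_generated_subring)
    (metis assms(1) assms(3) commute_generated_subring)

text \<open>Multiply by \<open>b'\<close> on the left and \<open>a'\<close> on the right. All
  commutation rules for the adjoined inverses \<open>P j\<close> and \<open>M j\<close> come from
  this.\<close>

lemma intertwine_inverse:
  fixes t :: "'a::{ring, monoid_mult}"
  assumes "t * a = b * t" and "a * a' = 1" and "b' * b = 1"
  shows "t * a' = b' * t"
proof -
  have "b' * t = b' * (t * a) * a'" using assms(2) by (simp add: mult.assoc)
  also have "\<dots> = (b' * b) * (t * a')" using assms(1) by (simp add: mult.assoc)
  finally show ?thesis using assms(3) by simp
qed

text \<open>\<open>qp n\<close> and \<open>d\<close> stand for \<open>q\<^sup>n\<close> and \<open>1 / (q - q\<^sup>-\<^sup>1)\<close>. They are elements of the ring and not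
  complex numbers because the ring will be a product over all \<open>q\<close>. The sort is not
  \<^class>\<open>ring_1\<close>, which would require a proof that this product is nonzero.\<close>

locale q_scalars =
  fixes qp :: "int \<Rightarrow> 'a::{ring, monoid_mult}" and d :: 'a
  assumes qp_central: "a * qp n = qp n * a"
    and d_central: "a * d = d * a"
    and qp_add: "qp m * qp n = qp (m + n)"
    and qp_0 [simp]: "qp 0 = 1"
    and d_inverse: "d * (qp 1 - qp (-1)) = 1"
begin

lemma qp_left: "a * (qp n * b) = qp n * (a * b)"
  by (metis mult.assoc qp_central)

lemma d_left: "a * (d * b) = d * (a * b)"
  by (metis mult.assoc d_central)

lemma qp_add_left: "qp m * (qp n * a) = qp (m + n) * a"
  by (simp add: qp_add flip: mult.assoc)

lemma weight_inverse:
  assumes "a * a' = 1" "a' * a = 1" and "a * t = qp n * t * a"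
  shows "a' * t = qp (- n) * t * a'"
proof -
  have "qp (- n) * t * a' = a' * (a * (qp (- n) * t * a'))" by (simp add: assms(2) flip: mult.assoc)
  also have "\<dots> = a' * (qp (- n) * (a * t) * a')" by (metis mult.assoc qp_central)
  also have "\<dots> = a' * t" by (simp add: assms qp_add qp_add_left mult.assoc)
  finally show ?thesis by simp
qed

text \<open>Move \<open>t\<close> to the left. The coefficients of \<open>a * a\<close> and
  \<open>a' * a'\<close> are \<open>(q^s - q) * (q^s - q^-1)\<close> and the same with
  \<open>-s\<close>, which vanish for \<open>s\<close> equal to 1 or -1. The constant term is
  \<open>(q + q^-1)^2 - 4 = (q - q^-1)^2\<close>, which \<open>cc\<close> turns into -1.\<close>

lemma serre_linear:
  assumes a: "a * a' = 1" "a' * a = 1" and s: "s = 1 \<or> s = -1" and t: "a * t = qp s * t * a"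
    and c: "\<And>b. b * c = c * b" and cc: "c * c * (qp 1 - qp (-1)) * (qp 1 - qp (-1)) = - 1"
    and J: "J = c * (a - a')"
  shows "t * (J * J) - (qp 1 + qp (-1)) * (J * t * J) + J * J * t = - t"
proof -
  note t' = weight_inverse[OF a t]
  have left: "a * (t * z) = qp s * (t * (a * z))" "a' * (t * z) = qp (- s) * (t * (a' * z))"
    "a * (a' * z) = z" "a' * (a * z) = z" for z
    using t t' a by (simp_all flip: mult.assoc)
  have c_left: "b * (c * z) = c * (b * z)" for b z by (metis mult.assoc c)
  note nf = J algebra_simps t t' left a qp_central[of a] qp_central[of a'] qp_central[of t]
    qp_central[of c] qp_left[of a] qp_left[of a'] qp_left[of t] qp_left[of c] qp_add qp_add_left
    c[of a] c[of a'] c[of t] c_left[of a] c_left[of a'] c_left[of t]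
  have "t * (J * J) - (qp 1 + qp (-1)) * (J * t * J) + J * J * t
      = c * c * (qp 1 - qp (-1)) * (qp 1 - qp (-1)) * t"
    using s by (auto simp: nf)
  then show ?thesis by (simp add: cc)
qed

text \<open>The contributions of \<open>s * s\<close> and \<open>t * t\<close> vanish because
  \<open>q^2 - (q + q^-1) * q + 1 = 0\<close>, and likewise for \<open>q^-1\<close>. The mixed
  products leave \<open>c * (q - q^-1)\<close> times the left side of \<open>st\<close>.\<close>

lemma serre_quadratic:
  assumes a: "a * a' = 1" "a' * a = 1"
    and s: "a * s = qp 1 * s * a" and t: "a * t = qp (-1) * t * a"
    and c: "\<And>b. b * c = c * b"
    and st: "s * t * (qp (-1) * a + qp 1 * a') - t * s * (qp 1 * a + qp (-1) * a')
      = - (d * (a - a'))"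
    and J: "J = c * (a - a')" and L: "L = s + t"
  shows "J * (L * L) - (qp 1 + qp (-1)) * (L * J * L) + L * L * J = - J"
proof -
  have s': "a' * s = qp (-1) * s * a'" and t': "a' * t = qp 1 * t * a'"
    using weight_inverse[OF a s] weight_inverse[OF a t] by simp_all
  have left: "a * (t * z) = qp (-1) * (t * (a * z))" "a' * (t * z) = qp 1 * (t * (a' * z))"
    "a * (s * z) = qp 1 * (s * (a * z))" "a' * (s * z) = qp (-1) * (s * (a' * z))" for z
    using s t s' t' by (simp_all flip: mult.assoc)
  have c_left: "b * (c * z) = c * (b * z)" for b z by (metis mult.assoc c)
  note nf = J L algebra_simps s t s' t' left a qp_central[of a] qp_central[of a'] qp_central[of s]
    qp_central[of t]
    qp_central[of c] qp_left[of a] qp_left[of a'] qp_left[of s] qp_left[of t] qp_left[of c] qp_add qp_add_left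
    c[of a] c[of a'] c[of t] c[of s] c_left[of a] c_left[of a'] c_left[of s] c_left[of t]
  have "J * (L * L) - (qp 1 + qp (-1)) * (L * J * L) + L * L * J
      = c * (qp 1 - qp (-1))
        * (s * t * (qp (-1) * a + qp 1 * a') - t * s * (qp 1 * a + qp (-1) * a'))"
    by (simp add: nf)
  also have "\<dots> = - (c * (qp 1 - qp (-1)) * d * (a - a'))"
    by (simp only: st) (simp add: mult.assoc)
  also have "\<dots> = - J"
    by (simp add: J mult.assoc d_inverse d_central[of "qp 1 - qp (-1)"] flip: mult.assoc[of _ d])
  finally show ?thesis .
qed

end

section \<open>The extended tensor square\<close>

locale uq_sl2 = q_scalars qp d for qp :: "int \<Rightarrow> 'a::{ring, monoid_mult}" and d +
  fixes e f k k' :: 'a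
  assumes kk': "k * k' = 1" and k'k: "k' * k = 1"
    and ke: "k * e = qp 1 * (e * k)" and kf: "k * f = qp (-1) * (f * k)"
    and ef_fe: "e * f - f * e = d * (k * k - k' * k')"
begin

lemma ek: "e * k = qp (-1) * k * e"
  by (simp add: mult.assoc ke qp_add_left)

lemma fk: "f * k = qp 1 * k * f"
  by (simp add: mult.assoc kf qp_add_left)

lemma ek': "e * k' = qp 1 * k' * e"
  by (rule intertwine_inverse[OF ek kk'])
    (simp add: mult.assoc qp_left[of k'] qp_add qp_add_left k'k)

lemma fk': "f * k' = qp (-1) * k' * f"
  by (rule intertwine_inverse[OF fk kk'])
    (simp add: mult.assoc qp_left[of k'] qp_add qp_add_left k'k)

text \<open>The Casimir element, rescaled by \<open>(q - q\<^sup>-\<^sup>1)\<^sup>2\<close>.\<close>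

definition kap :: 'a where
  "kap = (qp 1 - qp (-1)) * (qp 1 - qp (-1)) * (e * f) + qp (-1) * (k * k) + qp 1 * (k' * k')"

lemma kap_fe:
  "kap = (qp 1 - qp (-1)) * (qp 1 - qp (-1)) * (f * e) + qp 1 * (k * k) + qp (-1) * (k' * k')"
proof -
  let ?D = "qp 1 - qp (-1)"
  have "?D * ?D * (e * f - f * e) = ?D * (k * k - k' * k')"
    unfolding ef_fe by (metis d_inverse d_left mult.assoc mult_1_left)
  then have "?D * ?D * (e * f) = ?D * (k * k - k' * k') + ?D * ?D * (f * e)"
    by (simp only: right_diff_distrib[of "?D * ?D"] diff_eq_eq)
  then show ?thesis
    unfolding kap_def by (simp add: algebra_simps)
qed

lemma kap_commute:
  assumes "b \<in> {e, f, k, k'}"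
  shows "kap * b = b * kap"
proof -
  let ?D = "qp 1 - qp (-1)"
  have left: "e * (k * z) = qp (-1) * (k * (e * z))" "e * (k' * z) = qp 1 * (k' * (e * z))"
    "f * (k * z) = qp 1 * (k * (f * z))" "f * (k' * z) = qp (-1) * (k' * (f * z))"
    "k * (k' * z) = z" "k' * (k * z) = z" for z
    using ek ek' fk fk' kk' k'k by (simp_all flip: mult.assoc)
  note move = algebra_simps left ek ek' fk fk' kk' k'k qp_left[of e] qp_left[of f] qp_left[of k]
    qp_left[of k'] qp_add qp_add_left
  \<comment> \<open>Writing one \<open>kap\<close> with \<open>e * f\<close> and the other with
    \<open>f * e\<close> produces the word \<open>e * f * e\<close> on both sides, so only terms in
    \<open>k\<close> and \<open>k'\<close> remain to be compared. The case of \<open>f\<close> is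
    analogous.\<close>
  have "kap * e = e * kap"
    by (subst (2) kap_fe) (simp add: kap_def move)
  moreover have "kap * f = f * kap"
    by (subst (1) kap_fe) (simp add: kap_def move)
  moreover have "kap * k = k * kap" "kap * k' = k' * kap"
    unfolding kap_def by (simp_all add: move)
  ultimately show ?thesis using assms by blast
qed

lemma ef: "e * f = d * d * (kap - (qp (-1) * (k * k) + qp 1 * (k' * k')))"
proof -
  have "d * d * ((qp 1 - qp (-1)) * (qp 1 - qp (-1)) * (e * f)) = e * f"
    by (metis d_inverse d_left mult.assoc mult_1_left)
  then show ?thesis by (simp add: kap_def)
qed

lemma fe: "f * e = d * d * (kap - (qp 1 * (k * k) + qp (-1) * (k' * k')))"
proof -
  have "d * d * ((qp 1 - qp (-1)) * (qp 1 - qp (-1)) * (f * e)) = f * e"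
    by (metis d_inverse d_left mult.assoc mult_1_left)
  then show ?thesis by (simp add: kap_fe)
qed

end

section \<open>Adjoining \<open>x\<close> and its inverse \<open>y\<close>\<close>

locale hat_sl2 = uq_sl2 qp d e f k k'
  for qp :: "int \<Rightarrow> 'a::{ring, monoid_mult}" and d e f k k' +
  fixes x y :: 'a
  assumes x_commute: "\<And>b. b \<in> {e, f, k, k'} \<Longrightarrow> x * b = b * x"
    and x_quartic: "qp (-1) * (x * x * x * x) - kap * (x * x) + qp 1 = 0"
    and y_eq: "y = qp (-1) * (kap * x - qp (-1) * (x * x * x))"
begin

lemma kap_x: "kap * x = x * kap"
proof -
  have "x * (b * z) = b * (x * z)" if "b \<in> {e, f, k, k'}" for b z
    by (metis mult.assoc x_commute[OF that])
  then show ?thesis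
    unfolding kap_def by (simp add: algebra_simps qp_left[of x] x_commute)
qed

lemma y_commute:
  assumes "b \<in> {e, f, k, k', x}"
  shows "y * b = b * y"
proof -
  have "x * b = b * x" "kap * b = b * kap"
    using assms x_commute kap_commute kap_x by blast+
  then have "(x * x * x) * b = b * (x * x * x)" "(kap * x) * b = b * (kap * x)"
    by (metis mult.assoc)+
  then show ?thesis
    unfolding y_eq by (simp add: algebra_simps qp_left[of b])
qed

lemma xy: "x * y = 1"
proof -
  have "x * (kap * x) = kap * (x * x)"
    by (metis mult.assoc kap_x)
  then have "x * y = qp (-1) * (kap * (x * x) - qp (-1) * (x * x * x * x))"
    unfolding y_eq by (simp add: algebra_simps qp_left[of x])
  also have "kap * (x * x) - qp (-1) * (x * x * x * x) = qp 1"
    using x_quartic by (simp add: algebra_simps)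
  finally show ?thesis by (simp add: qp_add)
qed

text \<open>The quartic multiplied by \<open>y * y\<close>. It exhibits the Casimir as a Laurent
  polynomial in \<open>x\<close>, of the same shape as its part in \<open>k\<close> and
  \<open>k'\<close>.\<close>

lemma kap_eq: "kap = qp (-1) * (x * x) + qp 1 * (y * y)"
proof -
  have "(qp (-1) * (x * x * x * x) - kap * (x * x) + qp 1) * (y * y) = 0"
    unfolding x_quartic by simp
  moreover have "x * x * (y * y) = 1" "x * x * x * x * (y * y) = x * x"
    using xy by (metis mult.assoc mult_1_right)+
  ultimately show ?thesis
    by (simp add: left_diff_distrib distrib_right mult.assoc algebra_simps)
qed

lemma torus_commute: "a \<in> {k, k', x, y} \<Longrightarrow> b \<in> {k, k', x, y} \<Longrightarrow> a * b = b * a"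
  by (auto simp: kk' k'k x_commute y_commute)

end

section \<open>Two commuting copies and the adjoined inverses\<close>

locale uq_ext =
  first: hat_sl2 qp d e1 f1 k1 k1' x1 y1 + second: hat_sl2 qp d e2 f2 k2 k2' x2 y2
  for qp :: "int \<Rightarrow> 'a::{ring, monoid_mult}" and d
    and e1 f1 k1 k1' x1 y1 e2 f2 k2 k2' x2 y2 :: 'a +
  fixes P M :: "int \<Rightarrow> 'a"
  assumes cross: "\<And>a b. a \<in> {e1, f1, k1, k1', x1, y1} \<Longrightarrow> b \<in> {e2, f2, k2, k2', x2, y2} \<Longrightarrow>
      a * b = b * a"
    and hP: "(qp j * k1 * k2 + qp (- j) * k1' * k2') * P j = 1"
    and Ph: "P j * (qp j * k1 * k2 + qp (- j) * k1' * k2') = 1"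
    and hM: "(qp j * k1 * k2' + qp (- j) * k1' * k2) * M j = 1"
    and Mh: "M j * (qp j * k1 * k2' + qp (- j) * k1' * k2) = 1"
begin

lemmas qp_central = first.qp_central and qp_left = first.qp_left
  and d_central = first.d_central
  and qp_add = first.qp_add first.qp_add_left

definition hp :: "int \<Rightarrow> 'a" where "hp j = qp j * k1 * k2 + qp (- j) * k1' * k2'"
definition hm :: "int \<Rightarrow> 'a" where "hm j = qp j * k1 * k2' + qp (- j) * k1' * k2"

text \<open>The elements whose mutual commutation is immediate. \<open>P j\<close> and
  \<open>M j\<close> are added only in \<open>torus\<close>, since their commutation is deduced from
  that of \<open>torus0\<close>.\<close>

definition torus0 :: "'a set" where
  "torus0 = {k1, k1', k2, k2', x1, y1, x2, y2, d} \<union> range qp"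

lemma torus0_commute:
  assumes "a \<in> torus0" and "b \<in> torus0"
  shows "a * b = b * a"
proof -
  have "a * b = b * a" if "a \<in> insert d (range qp)"
    using that by (auto simp: qp_central[of b] d_central[of b])
  moreover have "a * b = b * a" if "b \<in> insert d (range qp)"
    using that by (auto simp: qp_central[of a] d_central[of a])
  moreover have "a * b = b * a" if "a \<in> {k1, k1', x1, y1}" "b \<in> {k2, k2', x2, y2}"
    using that by (intro cross) auto
  moreover have "a * b = b * a" if "b \<in> {k1, k1', x1, y1}" "a \<in> {k2, k2', x2, y2}"
    by (rule cross[symmetric]) (use that in auto)
  moreover note first.torus_commute[of a b] second.torus_commute[of a b]
  ultimately show ?thesis
    using assms unfolding torus0_def by blast
qed

lemma hp_mem: "hp j \<in> generated_subring torus0" and hm_mem: "hm j \<in> generated_subring torus0"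
  unfolding hp_def hm_def
  by (intro generated_subring.add generated_subring.mult generated_subring.base;
      simp add: torus0_def)+

lemmas hp_P = hP[folded hp_def] Ph[folded hp_def] and hm_M = hM[folded hm_def] Mh[folded hm_def]

lemma P_torus0: "a \<in> generated_subring torus0 \<Longrightarrow> a * P j = P j * a"
  by (rule intertwine_inverse[OF generated_subring_commute[OF torus0_commute _ hp_mem] hp_P])

lemma M_torus0: "a \<in> generated_subring torus0 \<Longrightarrow> a * M j = M j * a"
  by (rule intertwine_inverse[OF generated_subring_commute[OF torus0_commute _ hm_mem] hm_M])

definition torus :: "'a set" where
  "torus = generated_subring (torus0 \<union> range P \<union> range M)"

lemma torus_commute:
  assumes "a \<in> torus" and "b \<in> torus"
  shows "a * b = b * a"
proof (rule generated_subring_commute)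
  show "a \<in> generated_subring (torus0 \<union> range P \<union> range M)"
    "b \<in> generated_subring (torus0 \<union> range P \<union> range M)"
    using assms by (simp_all add: torus_def)
  \<comment> \<open>\<open>P i\<close> commutes with \<open>hp j\<close> and \<open>hm j\<close>,
    which lie in the subring generated by \<open>torus0\<close>, and therefore with their
    inverses.\<close>
  have P: "P i * b = b * P i" if "b \<in> torus0 \<union> range P \<union> range M" for i b
  proof -
    have "P i * P j = P j * P i" "P i * M j = M j * P i" for j
      by (rule intertwine_inverse[OF _ hp_P] intertwine_inverse[OF _ hm_M],
          rule P_torus0[symmetric]; rule hp_mem hm_mem)+
    then show ?thesis using that P_torus0[OF generated_subring.base, of b i] by auto
  qed
  have M: "M i * b = b * M i" if "b \<in> torus0 \<union> range P \<union> range M" for i b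
  proof -
    have "M i * P j = P j * M i" "M i * M j = M j * M i" for j
      by (rule intertwine_inverse[OF _ hp_P] intertwine_inverse[OF _ hm_M],
          rule M_torus0[symmetric]; rule hp_mem hm_mem)+
    then show ?thesis using that M_torus0[OF generated_subring.base, of b i] by auto
  qed
  show "a * b = b * a" if "a \<in> torus0 \<union> range P \<union> range M" "b \<in> torus0 \<union> range P \<union> range M" for a b
    using that P[of b] P[of a] M[of b] M[of a] torus0_commute[of a b] by auto
qed

text \<open>As conditional rewrite rules, the commutation laws make the simplifier normalise products in the
  commutative subring \<open>torus\<close>.\<close>

lemma torus_left_commute: "a \<in> torus \<Longrightarrow> b \<in> torus \<Longrightarrow> a * (b * c) = b * (a * c)"
  by (metis mult.assoc torus_commute)

lemma torus_closed [simp]: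
  "a \<in> torus \<Longrightarrow> b \<in> torus \<Longrightarrow> a + b \<in> torus"
  "a \<in> torus \<Longrightarrow> b \<in> torus \<Longrightarrow> a - b \<in> torus"
  "a \<in> torus \<Longrightarrow> b \<in> torus \<Longrightarrow> a * b \<in> torus"
  by (simp_all add: torus_def generated_subring.intros)

lemma torus_gens [simp]:
  "k1 \<in> torus" "k1' \<in> torus" "k2 \<in> torus" "k2' \<in> torus" "x1 \<in> torus" "y1 \<in> torus" "x2 \<in> torus"
  "y2 \<in> torus" "d \<in> torus" "qp n \<in> torus" "P j \<in> torus" "M j \<in> torus"
  by (simp_all add: torus_def torus0_def generated_subring.base)

lemma hp_torus [simp]: "hp j \<in> torus" and hm_torus [simp]: "hm j \<in> torus"
  by (simp_all add: hp_def hm_def)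

lemmas torus_ac = mult.assoc torus_commute torus_left_commute

lemma cross_simps:
  "e1 * k2 = k2 * e1" "e1 * k2' = k2' * e1" "e1 * x2 = x2 * e1" "e1 * y2 = y2 * e1"
  "f1 * k2 = k2 * f1" "f1 * k2' = k2' * f1" "f1 * x2 = x2 * f1" "f1 * y2 = y2 * f1"
  "e2 * k1 = k1 * e2" "e2 * k1' = k1' * e2" "e2 * x1 = x1 * e2" "e2 * y1 = y1 * e2"
  "f2 * k1 = k1 * f2" "f2 * k1' = k1' * f2" "f2 * x1 = x1 * f2" "f2 * y1 = y1 * f2"
  by ((rule cross cross[symmetric]; simp; fail)+)

lemma own_simps:
  "e1 * x1 = x1 * e1" "e1 * y1 = y1 * e1" "f1 * x1 = x1 * f1" "f1 * y1 = y1 * f1"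
  "e2 * x2 = x2 * e2" "e2 * y2 = y2 * e2" "f2 * x2 = x2 * f2" "f2 * y2 = y2 * f2"
  by (simp_all add: first.x_commute first.y_commute second.x_commute second.y_commute)

lemma qp_neg_simps:
  "qp (- j) * (qp 1 * a) = qp (- (j - 1)) * a" "qp (- j) * (qp (-1) * a) = qp (- (j + 1)) * a"
  "qp j * (qp 1 * a) = qp (j + 1) * a" "qp j * (qp (-1) * a) = qp (j - 1) * a"
  by (simp_all add: qp_add algebra_simps)

lemma left_simps:
  "e1 * (k1 * z) = qp (-1) * (k1 * (e1 * z))" "e1 * (k1' * z) = qp 1 * (k1' * (e1 * z))"
  "f1 * (k1 * z) = qp 1 * (k1 * (f1 * z))" "f1 * (k1' * z) = qp (-1) * (k1' * (f1 * z))"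
  "e2 * (k2 * z) = qp (-1) * (k2 * (e2 * z))" "e2 * (k2' * z) = qp 1 * (k2' * (e2 * z))"
  "f2 * (k2 * z) = qp 1 * (k2 * (f2 * z))" "f2 * (k2' * z) = qp (-1) * (k2' * (f2 * z))"
  "e1 * (k2 * z) = k2 * (e1 * z)" "e1 * (k2' * z) = k2' * (e1 * z)"
  "f1 * (k2 * z) = k2 * (f1 * z)" "f1 * (k2' * z) = k2' * (f1 * z)"
  "e2 * (k1 * z) = k1 * (e2 * z)" "e2 * (k1' * z) = k1' * (e2 * z)"
  "f2 * (k1 * z) = k1 * (f2 * z)" "f2 * (k1' * z) = k1' * (f2 * z)"
  "e1 * (x2 * z) = x2 * (e1 * z)" "e1 * (y2 * z) = y2 * (e1 * z)"
  "f1 * (x2 * z) = x2 * (f1 * z)" "f1 * (y2 * z) = y2 * (f1 * z)"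
  "e2 * (x1 * z) = x1 * (e2 * z)" "e2 * (y1 * z) = y1 * (e2 * z)"
  "f2 * (x1 * z) = x1 * (f2 * z)" "f2 * (y1 * z) = y1 * (f2 * z)"
  "e1 * (x1 * z) = x1 * (e1 * z)" "e1 * (y1 * z) = y1 * (e1 * z)"
  "f1 * (x1 * z) = x1 * (f1 * z)" "f1 * (y1 * z) = y1 * (f1 * z)"
  "e2 * (x2 * z) = x2 * (e2 * z)" "e2 * (y2 * z) = y2 * (e2 * z)"
  "f2 * (x2 * z) = x2 * (f2 * z)" "f2 * (y2 * z) = y2 * (f2 * z)"
  by (simp_all add: first.ek first.ek' first.fk first.fk' second.ek second.ek' second.fk second.fk'
      cross_simps own_simps flip: mult.assoc)

lemmas move = mult.assoc distrib_left distrib_right left_simps cross_simps own_simps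
  first.ek first.ek' first.fk first.fk' second.ek second.ek' second.fk second.fk'
  qp_left[of e1] qp_left[of f1] qp_left[of e2] qp_left[of f2]
  qp_left[of k1] qp_left[of k1'] qp_left[of k2] qp_left[of k2'] qp_left[of x1] qp_left[of y1]
  qp_left[of x2] qp_left[of y2] qp_neg_simps

text \<open>On \<open>hm\<close> the generators of the second copy shift in the opposite direction,
  because \<open>k2\<close> enters there inverted.\<close>

lemma h_shift:
  "e1 * hp j = hp (j - 1) * e1" "e1 * hm j = hm (j - 1) * e1"
  "f1 * hp j = hp (j + 1) * f1" "f1 * hm j = hm (j + 1) * f1"
  "e2 * hp j = hp (j - 1) * e2" "e2 * hm j = hm (j + 1) * e2"
  "f2 * hp j = hp (j + 1) * f2" "f2 * hm j = hm (j - 1) * f2"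
  unfolding hp_def hm_def by (simp_all add: move)

lemma P_shift:
  "e1 * P j = P (j - 1) * e1" "f1 * P j = P (j + 1) * f1"
  "e2 * P j = P (j - 1) * e2" "f2 * P j = P (j + 1) * f2"
  by (rule intertwine_inverse[OF _ hp_P(1) hp_P(2)], rule h_shift)+

lemma M_shift:
  "e1 * M j = M (j - 1) * e1" "f1 * M j = M (j + 1) * f1"
  "e2 * M j = M (j + 1) * e2" "f2 * M j = M (j - 1) * f2"
  by (rule intertwine_inverse[OF _ hm_M(1) hm_M(2)], rule h_shift)+

text \<open>Brings a product of two terms into the form of a coefficient followed by a product of
  two generators.\<close>

lemma term_mult:
  assumes "t * c' = c'' * t" and "t * P i = P i' * t" and "t * M j = M j' * t"
  shows "(c * p * m * t) * (c' * P i * M j * s) = c * p * m * c'' * P i' * M j' * (t * s)"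
proof -
  have "t * (c' * P i * M j) = c'' * P i' * M j' * t"
    by (metis assms mult.assoc)
  then show ?thesis by (metis mult.assoc)
qed

section \<open>The four terms of the image of I_32 and their products\<close>

text \<open>The numerators of the four fractions, named after the generator that each
  multiplies.\<close>

definition cE1 where "cE1 = y2 * (qp 1 * k1') + x2 * (qp (-1) * k1)"
definition cF1 where "cF1 = y2 * (qp 1 * k1) + x2 * (qp (-1) * k1')"
definition cE2 where "cE2 = y1 * (qp 1 * k2') + x1 * (qp (-1) * k2)"
definition cF2 where "cF2 = y1 * (qp 1 * k2) + x1 * (qp (-1) * k2')"

text \<open>The terms of the image of \<open>I\<^sub>3\<^sub>2\<close> up to sign; the letters \<open>p\<close> and \<open>m\<close> tell whether the weight
  under \<open>k1 * k2\<close> and under \<open>k1 * k2'\<close> is \<open>q\<close> or \<open>q\<^sup>-\<^sup>1\<close>.\<close>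

definition tpp where "tpp = cE1 * P (-1) * M (-1) * e1"
definition tmm where "tmm = cF1 * P 1 * M 1 * f1"
definition tpm where "tpm = cE2 * P (-1) * M 1 * e2"
definition tmp where "tmp = cF2 * P 1 * M (-1) * f2"

lemmas c_defs = cE1_def cF1_def cE2_def cF2_def

lemma c_torus [simp]: "cE1 \<in> torus" "cF1 \<in> torus" "cE2 \<in> torus" "cF2 \<in> torus"
  by (simp_all add: c_defs)

lemma c_shift:
  "e1 * cF1 = (y2 * k1 + x2 * k1') * e1" "f1 * cE1 = (y2 * k1' + x2 * k1) * f1"
  "e2 * cF2 = (y1 * k2 + x1 * k2') * e2" "f2 * cE2 = (y1 * k2' + x1 * k2) * f2"
  "e1 * cF2 = cF2 * e1" "f2 * cE1 = cE1 * f2" "e2 * cF1 = cF1 * e2" "f1 * cE2 = cE2 * f1"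
  unfolding c_defs by (simp_all add: move)

text \<open>The parts of the rescaled Casimir elements in \<open>k\<close> and \<open>k'\<close>:
  unprimed when the rest is written with \<open>e * f\<close>, primed when it is written with
  \<open>f * e\<close>.\<close>

definition g1 where "g1 = qp (-1) * (k1 * k1) + qp 1 * (k1' * k1')"
definition g2 where "g2 = qp (-1) * (k2 * k2) + qp 1 * (k2' * k2')"
definition g1' where "g1' = qp 1 * (k1 * k1) + qp (-1) * (k1' * k1')"
definition g2' where "g2' = qp 1 * (k2 * k2) + qp (-1) * (k2' * k2')"

lemmas g_defs = g1_def g2_def g1'_def g2'_def

lemma kg_torus [simp]:
  "first.kap \<in> torus" "second.kap \<in> torus" "g1 \<in> torus" "g2 \<in> torus" "g1' \<in> torus" "g2' \<in> torus"
  by (simp_all add: first.kap_eq second.kap_eq g_defs)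

lemma ef_simps:
  "e1 * f1 = d * d * (first.kap - g1)" "f1 * e1 = d * d * (first.kap - g1')"
  "e2 * f2 = d * d * (second.kap - g2)" "f2 * e2 = d * d * (second.kap - g2')"
  unfolding g_defs
  by (rule first.ef first.fe second.ef second.fe)+

lemma yx: "y1 * x1 = 1" "y2 * x2 = 1"
  using first.xy second.xy first.y_commute second.y_commute by simp_all

lemma k_cancel: "k1 * (k1' * z) = z" "k1' * (k1 * z) = z" "k2 * (k2' * z) = z" "k2' * (k2 * z) = z"
  "x1 * (y1 * z) = z" "x2 * (y2 * z) = z" "y1 * (x1 * z) = z" "y2 * (x2 * z) = z"
  by (simp_all add: first.kk' first.k'k second.kk' second.k'k first.xy second.xy yx flip: mult.assoc)

lemmas k_simps = k_cancel first.kk' first.k'k second.kk' second.k'k first.xy second.xy yx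

text \<open>Of the four products of summands, two lose \<open>k\<close> and \<open>k'\<close> and
  form the Casimir of the other copy by \<open>kap_eq\<close>; the other two lose \<open>x\<close>
  and \<open>y\<close> and form \<open>g\<close>.\<close>

lemma c_products:
  "cE1 * (y2 * k1 + x2 * k1') = second.kap + g1" "cF1 * (y2 * k1' + x2 * k1) = second.kap + g1'"
  "cE2 * (y1 * k2 + x1 * k2') = first.kap + g2" "cF2 * (y1 * k2' + x1 * k2) = first.kap + g2'"
  unfolding c_defs first.kap_eq second.kap_eq g_defs
  by (simp_all add: algebra_simps torus_ac k_simps qp_add)

text \<open>Moving the first generator to the right shifts the inverses of the second term to
  \<open>P 0 * M 0\<close> in all four cases; the factor \<open>hp\<close> cancels the
  \<open>P\<close> of the first term.\<close>

lemma diagonal_products: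
  "tpp * tmm * hp (-1) = d * d * ((second.kap + g1) * (first.kap - g1)) * M (-1) * (P 0 * M 0)"
  "tpm * tmp * hp (-1) = d * d * ((first.kap + g2) * (second.kap - g2)) * M 1 * (P 0 * M 0)"
  "tmm * tpp * hp 1 = d * d * ((second.kap + g1') * (first.kap - g1')) * M 1 * (P 0 * M 0)"
  "tmp * tpm * hp 1 = d * d * ((first.kap + g2') * (second.kap - g2')) * M (-1) * (P 0 * M 0)"
proof -
  have *: "c * P i * m * c' * p * m' * (d * d * r) * hp i = d * d * ((c * c') * r) * m * (p * m')"
    if "c \<in> torus" "m \<in> torus" "c' \<in> torus" "p \<in> torus" "m' \<in> torus" "r \<in> torus"
    for c m c' p m' r i
  proof -
    have "c * P i * m * c' * p * m' * (d * d * r) * hp i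
        = d * d * ((c * c') * r) * m * (p * m') * (P i * hp i)"
      using that by (simp add: torus_ac)
    then show ?thesis by (simp add: hp_P)
  qed
  show "tpp * tmm * hp (-1) = d * d * ((second.kap + g1) * (first.kap - g1)) * M (-1) * (P 0 * M 0)"
    unfolding tpp_def tmm_def term_mult[OF c_shift(1) P_shift(1) M_shift(1)] ef_simps
    by (subst *) (simp_all add: c_products)
  show "tpm * tmp * hp (-1) = d * d * ((first.kap + g2) * (second.kap - g2)) * M 1 * (P 0 * M 0)"
    unfolding tpm_def tmp_def term_mult[OF c_shift(3) P_shift(3) M_shift(3)] ef_simps
    by (subst *) (simp_all add: c_products)
  show "tmm * tpp * hp 1 = d * d * ((second.kap + g1') * (first.kap - g1')) * M 1 * (P 0 * M 0)"
    unfolding tpp_def tmm_def term_mult[OF c_shift(2) P_shift(2) M_shift(2)] ef_simps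
    by (subst *) (simp_all add: c_products)
  show "tmp * tpm * hp 1 = d * d * ((first.kap + g2') * (second.kap - g2')) * M (-1) * (P 0 * M 0)"
    unfolding tpm_def tmp_def term_mult[OF c_shift(4) P_shift(4) M_shift(4)] ef_simps
    by (subst *) (simp_all add: c_products)
qed

text \<open>One generator raises and the other lowers the index of \<open>hp\<close>, so the shifts
  cancel.\<close>

lemma hp_e_f:
  "e1 * f2 * hp j = hp j * (e1 * f2)" "f2 * e1 * hp j = hp j * (f2 * e1)"
  "e2 * f1 * hp j = hp j * (e2 * f1)" "f1 * e2 * hp j = hp j * (f1 * e2)"
  using h_shift by (simp_all add: mult.assoc)
     (simp_all flip: mult.assoc add: h_shift)

text \<open>Once \<open>hp\<close> has cancelled the \<open>P\<close> of the first term, both sides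
  have the same coefficients, and generators of different copies commute.\<close>

lemma off_diagonal_products:
  "tpp * tmp * hp (-1) = tmp * tpp * hp 1" "tpm * tmm * hp (-1) = tmm * tpm * hp 1"
proof -
  have *: "c * P i * m * c' * p * m' * t * hp i = c * c' * m * p * m' * t"
    if "c \<in> torus" "m \<in> torus" "c' \<in> torus" "p \<in> torus" "m' \<in> torus"
      "t * hp i = hp i * t" for c m c' p m' t i
  proof -
    have "c * P i * m * c' * p * m' * t * hp i = c * P i * m * c' * p * m' * hp i * t"
      using that by (simp add: mult.assoc)
    also have "\<dots> = c * c' * m * p * m' * (P i * hp i) * t"
      using that by (simp add: torus_ac)
    finally show ?thesis by (simp add: hp_P)
  qed
  have "e1 * f2 = f2 * e1" "e2 * f1 = f1 * e2"
    using cross[of e1 f2] cross[of f1 e2] by simp_all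
  then show "tpp * tmp * hp (-1) = tmp * tpp * hp 1" "tpm * tmm * hp (-1) = tmm * tpm * hp 1"
    unfolding tpp_def tmm_def tpm_def tmp_def term_mult[OF c_shift(5) P_shift(1) M_shift(1)]
      term_mult[OF c_shift(6) P_shift(4) M_shift(4)] term_mult[OF c_shift(7) P_shift(3) M_shift(3)]
      term_mult[OF c_shift(8) P_shift(2) M_shift(2)]
    by (simp_all add: * hp_e_f) (simp_all add: torus_ac)
qed

text \<open>These factorisations supply what cancels the denominators: \<open>hp 0\<close> and
  \<open>hm\<close> at -1 and 1 from the first two, \<open>hm 0\<close> from the third.\<close>

lemma g_sums: "g1 + g2' = hp 0 * hm (-1)" "g2 + g1' = hp 0 * hm 1"
  "(g2' - g1) + (g1' - g2) = (qp 1 - qp (-1)) * (k1 * k2 - k1' * k2') * hm 0"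
  unfolding g_defs hp_def hm_def
  by (simp_all add: algebra_simps torus_ac k_simps qp_add)

text \<open>Serves to combine two diagonal products, one from each copy, with the same factor
  \<open>M\<close>; by \<open>g_sums\<close> the sum \<open>g + h\<close> then contains the
  \<open>hm\<close> that cancels it.\<close>

lemma factor_difference:
  assumes "a \<in> torus" "b \<in> torus" "g \<in> torus" "h \<in> torus"
  shows "(b + g) * (a - g) - (a + h) * (b - h) = (g + h) * (a - b + (h - g))"
  using assms by (simp add: algebra_simps torus_ac)

lemma diagonal_sum:
  "(tpp * tmm + tpm * tmp) * hp (-1) - (tmm * tpp + tmp * tpm) * hp 1 = d * (k1 * k2 - k1' * k2')"
proof -
  let ?A = "k1 * k2 - k1' * k2'"
  have "(tpp * tmm + tpm * tmp) * hp (-1) - (tmm * tpp + tmp * tpm) * hp 1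
      = d * d *
      ((((second.kap + g1) * (first.kap - g1) - (first.kap + g2') * (second.kap - g2')) * M (-1)
        + ((first.kap + g2) * (second.kap - g2) - (second.kap + g1') * (first.kap - g1')) * M 1)
       * (P 0 * M 0))"
    unfolding distrib_right diagonal_products
    by (simp only: mult.assoc)
      (simp add: left_diff_distrib right_diff_distrib distrib_left distrib_right mult.assoc)
  also have "((second.kap + g1) * (first.kap - g1) - (first.kap + g2') * (second.kap - g2')) * M (-1)
      = hp 0 * (first.kap - second.kap + (g2' - g1)) * (hm (-1) * M (-1))"
    by (simp add: factor_difference g_sums) (simp add: torus_ac)
  also have "((first.kap + g2) * (second.kap - g2) - (second.kap + g1') * (first.kap - g1')) * M 1
      = hp 0 * (second.kap - first.kap + (g1' - g2)) * (hm 1 * M 1)"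
    by (simp add: factor_difference g_sums) (simp add: torus_ac)
  \<comment> \<open>With \<open>M (-1)\<close> and \<open>M 1\<close> gone, the two differences of
    Casimir elements are opposite and cancel.\<close>
  also have "hp 0 * (first.kap - second.kap + (g2' - g1)) * (hm (-1) * M (-1))
        + hp 0 * (second.kap - first.kap + (g1' - g2)) * (hm 1 * M 1)
      = hp 0 * ((g2' - g1) + (g1' - g2))"
    by (simp add: hm_M flip: distrib_left)
  also have "\<dots> * (P 0 * M 0) = (qp 1 - qp (-1)) * ?A * (hp 0 * P 0) * (hm 0 * M 0)"
    unfolding g_sums by (simp add: torus_ac)
  also have "d * d * \<dots> = d * ((d * (qp 1 - qp (-1))) * ?A)"
    by (simp add: hp_P hm_M mult.assoc)
  finally show ?thesis by (simp add: first.d_inverse)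
qed

lemma k_products_inverse: "k1 * k2 * (k1' * k2') = 1" "k1' * k2' * (k1 * k2) = 1"
  by (simp_all add: torus_ac k_simps)

lemma weights:
  "k1 * k2 * tpp = qp 1 * tpp * (k1 * k2)" "k1 * k2 * tpm = qp 1 * tpm * (k1 * k2)"
  "k1 * k2 * tmp = qp (-1) * tmp * (k1 * k2)" "k1 * k2 * tmm = qp (-1) * tmm * (k1 * k2)"
proof -
  have *: "k1 * k2 * (c * p * m * t) = qp n * (c * p * m * t) * (k1 * k2)"
    if "c \<in> torus" "p \<in> torus" "m \<in> torus" "t * (k1 * k2) = qp (-n) * (k1 * k2) * t" for c p m t n
  proof -
    have "qp n * (c * p * m * t) * (k1 * k2) = qp n * (c * p * m) * (qp (-n) * (k1 * k2) * t)"
      using that(4) by (simp add: mult.assoc)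
    also have "\<dots> = k1 * k2 * (c * p * m) * t"
      using that(1-3) by (simp add: torus_ac qp_add)
    finally show ?thesis by (simp add: mult.assoc)
  qed
  show "k1 * k2 * tpp = qp 1 * tpp * (k1 * k2)" "k1 * k2 * tpm = qp 1 * tpm * (k1 * k2)"
    "k1 * k2 * tmp = qp (-1) * tmp * (k1 * k2)" "k1 * k2 * tmm = qp (-1) * tmm * (k1 * k2)"
    unfolding tpp_def tpm_def tmp_def tmm_def by (rule *; simp add: move)+
qed

definition i32 where "i32 = - tpm + tmp + tpp - tmm"

section \<open>The Serre relations between I_21 and I_32\<close>

context
  fixes c i21
  assumes c: "\<And>b. b * c = c * b" and cc: "c * c * (qp 1 - qp (-1)) * (qp 1 - qp (-1)) = - 1"
    and i21: "i21 = c * (k1 * k2 - k1' * k2')"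
begin

text \<open>With \<open>s\<close> and \<open>t\<close> the parts of weight 1 and -1 under
  \<open>k1 * k2\<close>, the hypothesis of \<open>serre_quadratic\<close> splits into
  \<open>off_diagonal_products\<close>, which cancel, and \<open>diagonal_sum\<close>.\<close>

lemma serre_i21_i32:
  "i21 * (i32 * i32) - (qp 1 + qp (-1)) * (i32 * i21 * i32) + i32 * i32 * i21 = - i21"
proof (rule first.serre_quadratic[OF k_products_inverse, where s = "tpp - tpm" and t = "tmp - tmm"])
  show "k1 * k2 * (tpp - tpm) = qp 1 * (tpp - tpm) * (k1 * k2)"
    "k1 * k2 * (tmp - tmm) = qp (-1) * (tmp - tmm) * (k1 * k2)"
    by (simp_all add: right_diff_distrib left_diff_distrib weights)
  have hp: "qp (-1) * (k1 * k2) + qp 1 * (k1' * k2') = hp (-1)"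
    "qp 1 * (k1 * k2) + qp (-1) * (k1' * k2') = hp 1"
    by (simp_all add: hp_def mult.assoc)
  show "(tpp - tpm) * (tmp - tmm) * (qp (-1) * (k1 * k2) + qp 1 * (k1' * k2')) -
      (tmp - tmm) * (tpp - tpm) * (qp 1 * (k1 * k2) + qp (-1) * (k1' * k2'))
      = - (d * (k1 * k2 - k1' * k2'))"
    unfolding hp diagonal_sum[symmetric]
    using off_diagonal_products by (simp add: algebra_simps)
qed (simp_all add: c i21 i32_def)

lemma serre_i32_i21:
  "i32 * (i21 * i21) - (qp 1 + qp (-1)) * (i21 * i32 * i21) + i21 * i21 * i32 = - i32"
proof -
  have "t * (i21 * i21) - (qp 1 + qp (-1)) * (i21 * t * i21) + i21 * i21 * t = - t"
    if t: "t \<in> {tpp, tpm, tmp, tmm}" for t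
  proof -
    obtain s where "s = 1 \<or> s = -1" "k1 * k2 * t = qp s * t * (k1 * k2)"
      using t weights by blast
    then show ?thesis by (rule first.serre_linear[OF k_products_inverse _ _ c cc i21])
  qed
  note t = this[of tpp] this[of tpm] this[of tmp] this[of tmm]
  let ?S = "\<lambda>t. t * (i21 * i21) - (qp 1 + qp (-1)) * (i21 * t * i21) + i21 * i21 * t"
  have "?S i32 = - ?S tpm + ?S tmp + ?S tpp - ?S tmm"
    unfolding i32_def by (simp add: algebra_simps)
  then show ?thesis using t by (simp add: i32_def)
qed

end

section \<open>The symmetry exchanging I_21 and I_43\<close>

text \<open>Inverting \<open>k2\<close> exchanges \<open>hp\<close> and \<open>hm\<close>, hence
  \<open>P\<close> and \<open>M\<close>. The Casimir of the second copy is preserved by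
  \<open>kap_fe\<close>, so \<open>x2\<close> and \<open>y2\<close> can stay.\<close>

lemma swap: "uq_ext qp d e1 f1 k1 k1' x1 y1 (- f2) (- e2) k2' k2 x2 y2 M P"
proof -
  have "uq_sl2 qp d (- f2) (- e2) k2' k2"
  proof
    have "k2' * f2 = qp 1 * (f2 * k2')" "k2' * e2 = qp (-1) * (e2 * k2')"
      by (simp_all add: move qp_add)
    then show "k2' * - f2 = qp 1 * (- f2 * k2')" "k2' * - e2 = qp (-1) * (- e2 * k2')"
      by simp_all
    show "- f2 * - e2 - - e2 * - f2 = d * (k2' * k2' - k2 * k2)"
      using second.ef_fe by (simp add: algebra_simps)
  qed (simp_all add: second.kk' second.k'k)
  then interpret swap: uq_sl2 qp d "- f2" "- e2" k2' k2 .
  have kap: "swap.kap = second.kap"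
    unfolding swap.kap_def second.kap_fe by (simp add: algebra_simps)
  have "hat_sl2 qp d (- f2) (- e2) k2' k2 x2 y2"
  proof
    show "x2 * a = a * x2" if "a \<in> {- f2, - e2, k2', k2}" for a
      using that second.x_commute by (elim insertE) simp_all
  qed (simp_all only: kap second.x_quartic second.y_eq)
  moreover have "a * b = b * a"
    if "a \<in> {e1, f1, k1, k1', x1, y1}" "b \<in> {- f2, - e2, k2', k2, x2, y2}" for a b
    using that(2) cross[OF that(1)] by (elim insertE) simp_all
  ultimately show ?thesis
    unfolding uq_ext_def uq_ext_axioms_def using first.hat_sl2_axioms hP Ph hM Mh by blast
qed

text \<open>The terms \<open>tpm\<close> and \<open>tmp\<close> are exchanged up to sign; they have
  opposite signs in \<open>i32\<close>, which the minus signs on \<open>f2\<close> and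
  \<open>e2\<close> compensate.\<close>

lemma i32_swap: "uq_ext.i32 qp e1 f1 k1 k1' x1 y1 (- f2) (- e2) k2' k2 x2 y2 M P = i32"
proof -
  interpret swap: uq_ext qp d e1 f1 k1 k1' x1 y1 "- f2" "- e2" k2' k2 x2 y2 M P by (rule swap)
  have "swap.tpp = tpp" "swap.tmm = tmm" "swap.tpm = - tmp" "swap.tmp = - tpm"
    unfolding tpp_def tmm_def tpm_def tmp_def swap.tpp_def swap.tmm_def swap.tpm_def swap.tmp_def
      c_defs swap.c_defs
    by (simp_all add: mult.assoc torus_left_commute[of "M _" "P _"])
  then show ?thesis by (simp add: swap.i32_def i32_def)
qed

lemma k_products_commute:
  "(k1 * k2 - k1' * k2') * (k1 * k2' - k1' * k2) = (k1 * k2' - k1' * k2) * (k1 * k2 - k1' * k2')"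
  by (rule torus_commute) simp_all

end

section \<open>The product of the target algebras over all parameters\<close>

text \<open>A quotient type cannot depend on \<open>q\<close>. The product of the algebras over all admissible \<open>q\<close> is one
  type, in which \<open>q\<close> itself is a central element.\<close>

definition admissible :: "complex \<Rightarrow> bool" where
  "admissible q \<longleftrightarrow> q \<noteq> 0 \<and> q \<noteq> 1 \<and> q \<noteq> -1"

text \<open>Components at other parameters are ignored, so that \<open>q - q^-1\<close> becomes
  invertible in the product.\<close>

definition fam_eq :: "(complex \<Rightarrow> ext_gen free_alg) \<Rightarrow> (complex \<Rightarrow> ext_gen free_alg) \<Rightarrow> bool" where
  "fam_eq a b \<longleftrightarrow> (\<forall>q. admissible q \<longrightarrow> a q - b q \<in> rel_ideal (ext_rels q))"

quotient_type ext_family = "complex \<Rightarrow> ext_gen free_alg" / fam_eq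
proof (rule equivpI)
  show "reflp fam_eq" by (simp add: reflp_def fam_eq_def rel_ideal_zero)
  show "symp fam_eq"
    unfolding symp_def fam_eq_def using rel_ideal_uminus by fastforce
  show "transp fam_eq"
    unfolding transp_def fam_eq_def using rel_ideal_add by fastforce
qed

instantiation ext_family :: "{ring, monoid_mult}"
begin

lift_definition zero_ext_family :: ext_family is "\<lambda>_. 0" .
lift_definition one_ext_family :: ext_family is "\<lambda>_. 1" .
lift_definition plus_ext_family :: "ext_family \<Rightarrow> ext_family \<Rightarrow> ext_family" is "\<lambda>a b q. a q + b q"
  unfolding fam_eq_def using rel_ideal_add by (fastforce simp: add_diff_add)
lift_definition minus_ext_family :: "ext_family \<Rightarrow> ext_family \<Rightarrow> ext_family" is "\<lambda>a b q. a q - b q"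
proof -
  fix a a' b b' assume "fam_eq a a'" "fam_eq b b'"
  then show "fam_eq (\<lambda>q. a q - b q) (\<lambda>q. a' q - b' q)"
    unfolding fam_eq_def using rel_ideal_diff[of "a _ - a' _" _ "b _ - b' _"]
    by (simp add: algebra_simps)
qed
lift_definition uminus_ext_family :: "ext_family \<Rightarrow> ext_family" is "\<lambda>a q. - a q"
  unfolding fam_eq_def using rel_ideal_uminus by fastforce
lift_definition times_ext_family :: "ext_family \<Rightarrow> ext_family \<Rightarrow> ext_family" is "\<lambda>a b q. a q * b q"
proof -
  fix a a' b b' assume *: "fam_eq a a'" "fam_eq b b'"
  have "a q * b q - a' q * b' q = (a q - a' q) * b q + a' q * (b q - b' q)" for q
    by (simp add: algebra_simps)
  then show "fam_eq (\<lambda>q. a q * b q) (\<lambda>q. a' q * b' q)"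
    using * by (simp add: fam_eq_def rel_ideal_add rel_ideal_mult_left rel_ideal_mult_right)
qed

instance
  by standard (transfer; simp add: fam_eq_def rel_ideal_zero algebra_simps)+

end

abbreviation fam :: "(complex \<Rightarrow> ext_gen free_alg) \<Rightarrow> ext_family" where
  "fam \<equiv> abs_ext_family"

lemma fam_eq_iff: "fam a = fam b \<longleftrightarrow> (\<forall>q. admissible q \<longrightarrow> a q - b q \<in> rel_ideal (ext_rels q))"
  by (simp add: ext_family.abs_eq_iff fam_eq_def)

lemma fam_eqI: "(\<And>q. admissible q \<Longrightarrow> a q - b q \<in> rel_ideal (ext_rels q)) \<Longrightarrow> fam a = fam b"
  by (simp add: fam_eq_iff)

lemma fam_cong: "(\<And>q. admissible q \<Longrightarrow> a q = b q) \<Longrightarrow> fam a = fam b"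
  by (simp add: fam_eq_iff rel_ideal_zero)

lemma fam_ops:
  "fam a + fam b = fam (\<lambda>q. a q + b q)" "fam a - fam b = fam (\<lambda>q. a q - b q)"
  "- fam a = fam (\<lambda>q. - a q)" "fam a * fam b = fam (\<lambda>q. a q * b q)"
  "1 = fam (\<lambda>_. 1)" "0 = fam (\<lambda>_. 0)"
  by (simp_all add: plus_ext_family.abs_eq minus_ext_family.abs_eq uminus_ext_family.abs_eq
      times_ext_family.abs_eq one_ext_family.abs_eq zero_ext_family.abs_eq)

section \<open>The defining relations in the product ring\<close>

definition q_pow :: "int \<Rightarrow> ext_family" where "q_pow n = fam (\<lambda>q. sc (q powi n))"
definition q_diff_inv :: ext_family where "q_diff_inv = fam (\<lambda>q. sc (1 / (q - inverse q)))"
definition fgen :: "ext_gen \<Rightarrow> ext_family" where "fgen g = fam (\<lambda>_. gen g)"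

lemma fam_sc_commute: "a * fam (\<lambda>q. sc (c q)) = fam (\<lambda>q. sc (c q)) * a"
  by (induction a rule: ext_family.abs_induct) (simp add: fam_ops sc_commute)

lemma admissible_diff: "admissible q \<Longrightarrow> q \<noteq> inverse q"
  unfolding admissible_def by (simp add: field_simps) (metis power2_eq_1_iff power2_eq_square)

interpretation scalars: q_scalars q_pow q_diff_inv
proof
  show "a * q_pow n = q_pow n * a" "a * q_diff_inv = q_diff_inv * a" for a n
    by (simp_all add: q_pow_def q_diff_inv_def fam_sc_commute)
  show "q_pow m * q_pow n = q_pow (m + n)" for m n
    unfolding q_pow_def fam_ops
    by (rule fam_cong) (simp add: admissible_def power_int_add flip: sc_mult)
  show "q_pow 0 = 1" by (simp add: q_pow_def fam_ops)
  show "q_diff_inv * (q_pow 1 - q_pow (-1)) = 1"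
    unfolding q_pow_def q_diff_inv_def fam_ops
    by (rule fam_cong) (simp add: admissible_diff power_int_minus flip: sc_mult sc_diff)
qed

text \<open>Multiplication by \<open>(q - q^-1)^2\<close>, nonzero at admissible parameters, clears
  the denominator in \<open>casimir\<close>; the right side is \<open>kap\<close> of the copy
  \<open>i\<close>.\<close>

lemma fam_casimir:
  "fam (\<lambda>q. casimir q i * sc ((q - inverse q)^2))
    = (q_pow 1 - q_pow (-1)) * (q_pow 1 - q_pow (-1)) * (fgen (E i) * fgen (F i))
    + q_pow (-1) * (fgen (K i) * fgen (K i)) + q_pow 1 * (fgen (Kinv i) * fgen (Kinv i))"
  unfolding q_pow_def fgen_def fam_ops
proof (rule fam_cong)
  fix q assume "admissible q"
  then have *: "sc ((q - inverse q)\<^sup>2) * (sc (1 / (q - inverse q)\<^sup>2) * a) = a"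
    for a :: "ext_gen free_alg"
    using admissible_diff by (simp flip: sc_mult mult.assoc)
  have "casimir q i * sc ((q - inverse q)^2) = sc ((q - inverse q)^2) * casimir q i"
    by (rule sc_commute)
  also have "\<dots> = sc ((q - inverse q)^2) * (gen (E i) * gen (F i))
      + (sc (inverse q) * gen (K i)^2 + sc q * gen (Kinv i)^2)"
    unfolding casimir_def distrib_left[of "sc ((q - inverse q)^2)"] * ..
  also have "\<dots>
    = (sc (q powi 1) - sc (q powi -1)) * (sc (q powi 1) - sc (q powi -1)) * (gen (E i) * gen (F i))
     + sc (q powi -1) * (gen (K i) * gen (K i)) + sc (q powi 1) * (gen (Kinv i) * gen (Kinv i))"
    by (simp add: power2_eq_square power_int_minus sc_mult add.assoc flip: sc_diff)
  finally show "casimir q i * sc ((q - inverse q)^2) = \<dots>" .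
qed

lemma hat_sl2_rels_subset: "hat_sl2_rels q i \<subseteq> ext_rels q"
  by (cases i) (auto simp: ext_rels_def tensor_rels_def)

lemma hat_sl2_rels_ideal: "r \<in> hat_sl2_rels q i \<Longrightarrow> r \<in> rel_ideal (ext_rels q)"
  using hat_sl2_rels_subset rel_ideal_base by blast

lemma uq_sl2_family:
  "uq_sl2 q_pow q_diff_inv (fgen (E i)) (fgen (F i)) (fgen (K i)) (fgen (Kinv i))"
  by (unfold_locales; unfold fgen_def q_pow_def q_diff_inv_def fam_ops;
      rule fam_eqI; rule hat_sl2_rels_ideal[where i = i];
      simp add: hat_sl2_rels_def sl2_rels_def power_int_minus power2_eq_square)

lemma fam_xinv:
  "fam (\<lambda>q. xinv q i) = q_pow (-1) *
    (uq_sl2.kap q_pow (fgen (E i)) (fgen (F i)) (fgen (K i)) (fgen (Kinv i)) * fgen (X i)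
     - q_pow (-1) * (fgen (X i) * fgen (X i) * fgen (X i)))"
  unfolding uq_sl2.kap_def[OF uq_sl2_family] fam_casimir[symmetric]
  unfolding fgen_def q_pow_def fam_ops
  by (rule fam_cong) (simp add: xinv_def power_int_minus power3_eq_cube mult.assoc)

lemma hat_sl2_family:
  "hat_sl2 q_pow q_diff_inv (fgen (E i)) (fgen (F i)) (fgen (K i)) (fgen (Kinv i))
    (fgen (X i)) (fam (\<lambda>q. xinv q i))"
proof -
  interpret uq_sl2 q_pow q_diff_inv "fgen (E i)" "fgen (F i)" "fgen (K i)" "fgen (Kinv i)"
    by (rule uq_sl2_family)
  show ?thesis
  proof
    show "fgen (X i) * b = b * fgen (X i)"
      if "b \<in> {fgen (E i), fgen (F i), fgen (K i), fgen (Kinv i)}" for b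
    proof -
      obtain g where g: "b = fgen g" "g \<in> {E i, F i, K i, Kinv i}" using \<open>b \<in> _\<close> by blast
      show ?thesis unfolding fgen_def g(1) fam_ops
        by (rule fam_eqI, rule hat_sl2_rels_ideal[where i = i])
          (use g(2) in \<open>auto simp: hat_sl2_rels_def\<close>)
    qed
    show "q_pow (-1) * (fgen (X i) * fgen (X i) * fgen (X i) * fgen (X i))
        - kap * (fgen (X i) * fgen (X i)) + q_pow 1 = 0"
      unfolding kap_def fam_casimir[symmetric]
  unfolding fgen_def q_pow_def fam_ops
      by (rule fam_eqI, rule hat_sl2_rels_ideal[where i = i])
        (simp add: hat_sl2_rels_def power_int_minus power2_eq_square power4_eq_xxxx mult.assoc)
  qed (rule fam_xinv)
qed

text \<open>The relations between the copies concern generators only. As a polynomial in the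
  generators of its own copy, the inverse of \<open>X i\<close> inherits the commutation.\<close>

lemma xinv_generated:
  "fam (\<lambda>q. xinv q i) \<in> generated_subring (fgen ` hat_sl2_gens i \<union> range q_pow)"
  unfolding fam_xinv uq_sl2.kap_def[OF uq_sl2_family]
  by (intro generated_subring.add generated_subring.diff generated_subring.mult
      generated_subring.base) (auto simp: hat_sl2_gens_def)

lemma cross_gens:
  "g \<in> hat_sl2_gens First \<Longrightarrow> h \<in> hat_sl2_gens Second \<Longrightarrow> fgen g * fgen h = fgen h * fgen g"
  unfolding fgen_def fam_ops
  by (rule fam_eqI, rule rel_ideal_base) (auto simp: ext_rels_def tensor_rels_def)

lemma cross_generated:
  assumes "a \<in> generated_subring (fgen ` hat_sl2_gens First \<union> range q_pow)"
    and "b \<in> generated_subring (fgen ` hat_sl2_gens Second \<union> range q_pow)"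
  shows "a * b = b * a"
  using assms(1)
proof (rule commute_generated_subring)
  fix c assume c: "c \<in> fgen ` hat_sl2_gens First \<union> range q_pow"
  have "b * c = c * b"
    using assms(2)
  proof (rule commute_generated_subring)
    fix c' assume c': "c' \<in> fgen ` hat_sl2_gens Second \<union> range q_pow"
    consider "c \<in> range q_pow" | "c' \<in> range q_pow"
      | "c \<in> fgen ` hat_sl2_gens First" "c' \<in> fgen ` hat_sl2_gens Second"
      using c c' by blast
    then show "c' * c = c * c'"
    proof cases
      case 1
      then show ?thesis using scalars.qp_central[of c'] by auto
    next
      case 2
      then show ?thesis using scalars.qp_central[of c] by auto
    next
      case 3
      then show ?thesis by (auto intro: cross_gens[symmetric])
    qed
  qed
  then show "c * b = b * c" by simp
qed

lemma uq_ext_family: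
  "uq_ext q_pow q_diff_inv
    (fgen (E First)) (fgen (F First)) (fgen (K First)) (fgen (Kinv First)) (fgen (X First))
    (fam (\<lambda>q. xinv q First))
    (fgen (E Second)) (fgen (F Second)) (fgen (K Second)) (fgen (Kinv Second)) (fgen (X Second))
    (fam (\<lambda>q. xinv q Second))
    (\<lambda>j. fgen (Pinv j)) (\<lambda>j. fgen (Minv j))"
proof (intro uq_ext.intro hat_sl2_family uq_ext_axioms.intro)
  have mem: "a \<in> generated_subring (fgen ` hat_sl2_gens i \<union> range q_pow)"
    if "a \<in> {fgen (E i), fgen (F i), fgen (K i), fgen (Kinv i), fgen (X i),
      fam (\<lambda>q. xinv q i)}" for a i
    using that xinv_generated[of i]
      generated_subring.base[of a "fgen ` hat_sl2_gens i \<union> range q_pow"]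
    by (auto simp: hat_sl2_gens_def)
  show "a * b = b * a"
    if "a \<in> {fgen (E First), fgen (F First), fgen (K First), fgen (Kinv First), fgen (X First),
        fam (\<lambda>q. xinv q First)}"
      "b \<in> {fgen (E Second), fgen (F Second), fgen (K Second), fgen (Kinv Second), fgen (X Second),
        fam (\<lambda>q. xinv q Second)}" for a b
    by (rule cross_generated[OF mem[OF that(1)] mem[OF that(2)]])
qed (unfold fgen_def q_pow_def fam_ops,
    (rule fam_eqI, rule rel_ideal_base, force simp: ext_rels_def hplus_def hminus_def)+)

interpretation ext: uq_ext q_pow q_diff_inv
  "fgen (E First)" "fgen (F First)" "fgen (K First)" "fgen (Kinv First)" "fgen (X First)"
  "fam (\<lambda>q. xinv q First)"
  "fgen (E Second)" "fgen (F Second)" "fgen (K Second)" "fgen (Kinv Second)" "fgen (X Second)"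
  "fam (\<lambda>q. xinv q Second)"
  "\<lambda>j. fgen (Pinv j)" "\<lambda>j. fgen (Minv j)"
  by (rule uq_ext_family)

interpretation ext_swap: uq_ext q_pow q_diff_inv
  "fgen (E First)" "fgen (F First)" "fgen (K First)" "fgen (Kinv First)" "fgen (X First)"
  "fam (\<lambda>q. xinv q First)"
  "- fgen (F Second)" "- fgen (E Second)" "fgen (Kinv Second)" "fgen (K Second)" "fgen (X Second)"
  "fam (\<lambda>q. xinv q Second)"
  "\<lambda>j. fgen (Minv j)" "\<lambda>j. fgen (Pinv j)"
  by (rule ext.swap)

section \<open>The images of the generators and the final homomorphism\<close>

definition i_coeff :: ext_family where "i_coeff = fam (\<lambda>q. sc (\<i> / (q - inverse q)))"

lemma i_coeff_central: "a * i_coeff = i_coeff * a"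
  unfolding i_coeff_def by (rule fam_sc_commute)

lemma i_coeff_square: "i_coeff * i_coeff * (q_pow 1 - q_pow (-1)) * (q_pow 1 - q_pow (-1)) = - 1"
  unfolding i_coeff_def q_pow_def fam_ops
proof (rule fam_cong)
  fix q assume q: "admissible q"
  let ?c = "\<i> / (q - inverse q)"
  have "sc ?c * sc ?c * (sc (q powi 1) - sc (q powi -1)) * (sc (q powi 1) - sc (q powi -1))
      = sc (?c * ?c * (q - inverse q) * (q - inverse q))"
    by (simp only: sc_mult sc_diff power_int_1_right power_int_minus)
  also have "?c * ?c * (q - inverse q) * (q - inverse q) = - 1"
    using admissible_diff[OF q] by simp
  also have "sc (- 1) = - (1 :: ext_gen free_alg)"
    by (simp add: sc_def single_uminus)
  finally show "sc ?c * sc ?c * (sc (q powi 1) - sc (q powi -1)) * (sc (q powi 1) - sc (q powi -1))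
      = - (1 :: ext_gen free_alg)" .
qed

lemma fam_img21:
  "fam img21 = i_coeff * (fgen (K First) * fgen (K Second) - fgen (Kinv First) * fgen (Kinv Second))"
  unfolding i_coeff_def fgen_def fam_ops img21_def ..

lemma fam_img43:
  "fam img43 = i_coeff * (fgen (K First) * fgen (Kinv Second) - fgen (Kinv First) * fgen (K Second))"
  unfolding i_coeff_def fgen_def fam_ops img43_def ..

lemma fam_img32: "fam img32 = ext.i32"
  unfolding ext.i32_def ext.tpp_def ext.tmm_def ext.tpm_def ext.tmp_def ext.c_defs
  unfolding fgen_def q_pow_def fam_ops img32_def
  by (simp add: power_int_minus)

text \<open>Passes from an identity in the product ring to its component at a single
  \<open>q\<close>.\<close>

lemma q_serre_family:
  assumes "a * (b * b) - (q_pow 1 + q_pow (-1)) * (b * a * b) + b * b * a = - a"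
    and "a = fam a'" "b = fam b'" and "admissible q"
  shows "q_serre q (a' q) (b' q) \<in> rel_ideal (ext_rels q)"
proof -
  have "q_serre q (a' q) (b' q)
      = a' q * (b' q * b' q) - (sc (q powi 1) + sc (q powi -1)) * (b' q * a' q * b' q)
        + b' q * b' q * a' q - - a' q"
    by (simp add: q_serre_def power2_eq_square sc_add power_int_minus)
  also have "\<dots> \<in> rel_ideal (ext_rels q)"
    using assms unfolding q_pow_def by (simp only: fam_ops fam_eq_iff)
  finally show ?thesis .
qed

lemma img_rels:
  assumes "admissible q"
  shows "q_serre q (img21 q) (img32 q) \<in> rel_ideal (ext_rels q)"
    "q_serre q (img32 q) (img21 q) \<in> rel_ideal (ext_rels q)"
    "q_serre q (img43 q) (img32 q) \<in> rel_ideal (ext_rels q)"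
    "q_serre q (img32 q) (img43 q) \<in> rel_ideal (ext_rels q)"
    "img21 q * img43 q - img43 q * img21 q \<in> rel_ideal (ext_rels q)"
proof -
  show "q_serre q (img21 q) (img32 q) \<in> rel_ideal (ext_rels q)"
    by (rule q_serre_family[OF
          ext.serre_i21_i32[OF i_coeff_central i_coeff_square refl]
          fam_img21[symmetric] fam_img32[symmetric] assms])
  show "q_serre q (img32 q) (img21 q) \<in> rel_ideal (ext_rels q)"
    by (rule q_serre_family[OF
          ext.serre_i32_i21[OF i_coeff_central i_coeff_square refl]
          fam_img32[symmetric] fam_img21[symmetric] assms])
  \<comment> \<open>In the swapped structure \<open>k1 * k2'\<close> takes the place of
    \<open>k1 * k2\<close>, so its \<open>i21\<close> is the image of I_43, while \<open>i32\<close>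
    is unchanged.\<close>
  show "q_serre q (img43 q) (img32 q) \<in> rel_ideal (ext_rels q)"
    by (rule q_serre_family[OF
          ext_swap.serre_i21_i32[OF i_coeff_central i_coeff_square refl, unfolded ext.i32_swap]
          fam_img43[symmetric] fam_img32[symmetric] assms])
  show "q_serre q (img32 q) (img43 q) \<in> rel_ideal (ext_rels q)"
    by (rule q_serre_family[OF
          ext_swap.serre_i32_i21[OF i_coeff_central i_coeff_square refl, unfolded ext.i32_swap]
          fam_img32[symmetric] fam_img43[symmetric] assms])
  have "fam img21 * fam img43 = fam img43 * fam img21"
    unfolding fam_img21 fam_img43 by (metis i_coeff_central ext.k_products_commute mult.assoc)
  then show "img21 q * img43 q - img43 q * img21 q \<in> rel_ideal (ext_rels q)"
    using assms by (simp add: fam_ops fam_eq_iff)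
qed

theorem theorem2:
  fixes q :: complex
  assumes "q \<noteq> 0" and "q \<noteq> 1" and "q \<noteq> -1"
  shows "\<exists>!\<phi>. \<phi> \<in> alg_hom (U'_so4 q) (U_sl2_ext q) \<and>
    \<phi> (cls (so4_rels q) (gen I21)) = cls (ext_rels q) (img21 q) \<and>
    \<phi> (cls (so4_rels q) (gen I43)) = cls (ext_rels q) (img43 q) \<and>
    \<phi> (cls (so4_rels q) (gen I32)) = cls (ext_rels q) (img32 q)"
proof -
  define img where "img = case_so4_gen (img21 q) (img32 q) (img43 q)"
  have "admissible q" using assms by (simp add: admissible_def)
  note rels = img_rels[OF this]
  have "free_lift img r \<in> rel_ideal (ext_rels q)" if "r \<in> so4_rels q" for r
    using that rels
    by (auto simp: so4_rels_def q_serre_def img_def power2_eq_square free_lift_simps)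
  then have "\<exists>!h. h \<in> alg_hom (presented_alg (so4_rels q)) (presented_alg (ext_rels q)) \<and>
      (\<forall>g. h (cls (so4_rels q) (gen g)) = cls (ext_rels q) (img g))"
    by (rule presented_alg_universal)
  \<comment> \<open>The three prescribed values are the values on all generators, so existence and
    uniqueness carry over together.\<close>
  moreover have "(\<forall>g. h (cls (so4_rels q) (gen g)) = cls (ext_rels q) (img g)) \<longleftrightarrow>
      h (cls (so4_rels q) (gen I21)) = cls (ext_rels q) (img21 q) \<and>
      h (cls (so4_rels q) (gen I43)) = cls (ext_rels q) (img43 q) \<and>
      h (cls (so4_rels q) (gen I32)) = cls (ext_rels q) (img32 q)" for h
    unfolding img_def by (auto split: so4_gen.split)
  ultimately show ?thesis
    by (simp add: U'_so4_def U_sl2_ext_def)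
qed

end
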